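(* Let $\alpha,\beta,b,c,z,s\in\mathbb{C}$ with $\mathrm{Re}(\alpha)>-1$, $\mathrm{Re}(c)>\mathrm{Re}(b)>0$ and $\mathrm{Re}(s)>0$. Then the Mellin transform with respect to $p$ of the $\Psi$-confluent hypergeometric function is $$\mathcal{M}\left\lbrace {}^{\Psi}\Phi_{p}^{(\alpha,\beta)}(b;c;z):s\right\rbrace=\int_0^\infty p^{s-1}\;{}^{\Psi}\Phi_{p}^{(\alpha,\beta)}(b;c;z)\,dp =\frac{{}^{\Psi}\Gamma^{(\alpha,\beta)}(s)\,B(b+s,c+s-b)}{B(b,c-b)}\;\Phi(b+s;c+2s;z).$$
   Context: For $\alpha,\beta\in\mathbb{C}$ with $\mathrm{Re}(\alpha)>-1$, the Wright function is ${}_{0}\Psi_{1}(\alpha,\beta;z)=\sum_{n=0}^{\infty}\frac{1}{\Gamma(\alpha n+\beta)}\frac{z^n}{n!}$ (with $1/\Gamma$ equal to $0$ at the poles of $\Gamma$). For $\mathrm{Re}(x)>0$, $\mathrm{Re}(y)>0$, $\mathrm{Re}(p)>0$ the $\Psi$-beta function is $${}^{\Psi}B_{p}^{(\alpha,\beta)}(x,y)=\int_{0}^{1}t^{x-1}(1-t)^{y-1}\,{}_{0}\Psi_{1}\left(\alpha,\beta;-\frac{p}{t(1-t)}\right)dt.$$ The $\Psi$-gamma function is ${}^{\Psi}\Gamma_{p}^{(\alpha,\beta)}(x)=\int_{0}^{\infty}t^{x-1}\,{}_{0}\Psi_{1}\left(\alpha,\beta;-t-\frac{p}{t}\right)dt$,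 and ${}^{\Psi}\Gamma^{(\alpha,\beta)}(s)$ denotes its case $p=0$, i.e. ${}^{\Psi}\Gamma^{(\alpha,\beta)}(s)=\int_{0}^{\infty}v^{s-1}\,{}_{0}\Psi_{1}(\alpha,\beta;-v)\,dv$. The $\Psi$-confluent hypergeometric function is $${}^{\Psi}\Phi_{p}^{(\alpha,\beta)}(b;c;z)=\sum_{n=0}^{\infty}\frac{{}^{\Psi}B_{p}^{(\alpha,\beta)}(b+n,c-b)}{B(b,c-b)}\frac{z^{n}}{n!}.$$ Here $B$ is the classical beta function and $\Phi(b;c;z)=\sum_{n=0}^\infty \frac{(b)_n}{(c)_n}\frac{z^n}{n!}$ is the classical confluent hypergeometric function, with $(\lambda)_n=\lambda(\lambda+1)\cdots(\lambda+n-1)$, $(\lambda)_0=1$.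
   Formalization: The formal theorem assumes that the integral defining ΨΓ^{(α,β)}(s) converges (possibly conditionally); this does not follow from Re(α)>-1, Re(s)>0 (e.g. α=1, β=3/2, Re(s)≥1), and without it the right-hand side is undefined. *)

theory Defs
  imports "HOL-Analysis.Analysis"
begin

text \<open>
  All integrals are Henstock-Kurzweil integrals. They extend the Lebesgue integral and also
  cover conditionally convergent improper integrals. The integrands are written with
  \<open>powr\<close>, which is the principal power for positive real base; their values at the endpoints
  of the intervals are irrelevant.
\<close>

text \<open>\<open>rGamma\<close> is the reciprocal Gamma function, which is \<open>0\<close> at the poles of \<open>Gamma\<close>.\<close>

definition wright :: "complex \<Rightarrow> complex \<Rightarrow> complex \<Rightarrow> complex" where
  "wright \<alpha> \<beta> z = (\<Sum>n. rGamma (\<alpha> * of_nat n + \<beta>) * z ^ n / fact n)"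

definition psi_beta :: "complex \<Rightarrow> complex \<Rightarrow> complex \<Rightarrow> complex \<Rightarrow> complex \<Rightarrow> complex" where
  "psi_beta \<alpha> \<beta> p x y =
     integral {0..1} (\<lambda>t::real. of_real t powr (x - 1) * of_real (1 - t) powr (y - 1) *
       wright \<alpha> \<beta> (- (p / of_real (t * (1 - t)))))"

definition psi_gamma :: "complex \<Rightarrow> complex \<Rightarrow> complex \<Rightarrow> complex \<Rightarrow> complex" where
  "psi_gamma \<alpha> \<beta> p x =
     integral {0..} (\<lambda>t::real. of_real t powr (x - 1) *
       wright \<alpha> \<beta> (- of_real t - p / of_real t))"

definition psi_confluent ::
    "complex \<Rightarrow> complex \<Rightarrow> complex \<Rightarrow> complex \<Rightarrow> complex \<Rightarrow> complex \<Rightarrow> complex" where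
  "psi_confluent \<alpha> \<beta> p b c z =
     (\<Sum>n. psi_beta \<alpha> \<beta> p (b + of_nat n) (c - b) / Beta b (c - b) * z ^ n / fact n)"

definition confluent :: "complex \<Rightarrow> complex \<Rightarrow> complex \<Rightarrow> complex" where
  "confluent b c z = (\<Sum>n. pochhammer b n / pochhammer c n * z ^ n / fact n)"

text \<open>
  A Mellin transform is only meaningful where its integral converges, so convergence is a
  separate predicate (\<open>integral\<close> is \<open>0\<close> for a non-integrable function).
\<close>

definition mellin_converges :: "(real \<Rightarrow> complex) \<Rightarrow> complex \<Rightarrow> bool" where
  "mellin_converges f s \<longleftrightarrow> (\<lambda>p. of_real p powr (s - 1) * f p) integrable_on {0..}"

definition mellin :: "(real \<Rightarrow> complex) \<Rightarrow> complex \<Rightarrow> complex" where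
  "mellin f s = integral {0..} (\<lambda>p. of_real p powr (s - 1) * f p)"

end

theory Submission
  imports Defs "HOL-Real_Asymp.Real_Asymp"
begin

text \<open>
  Write \<open>W v\<close> for the Wright function at \<open>-v\<close>, \<open>q = t(1-t)\<close>, and
  \<open>w(t) = t^(b+s-1) (1-t)^(c-b+s-1)\<close>. Formally the theorem is one application of Fubini:
  summing the series under the integral sign gives
  \[ B(b,c-b) \Phi_p(b;c;z) = \int_0^1 t^{b-1} (1-t)^{c-b-1} e^{zt} W(p/q) dt, \]
  and since \<open>W(p/q)\<close> has Mellin transform \<open>q^s\<close> times that of \<open>W\<close>, the Mellin transform
  factors into \<open>\<integral> v^(s-1) W v dv\<close> and \<open>\<integral> w(t) e^(zt) dt\<close>, where the second factor is a
  classical Beta and confluent series.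

  The difficulty is that \<open>\<integral> v^(s-1) W v dv\<close> is only known to converge conditionally. No
  pointwise bound on \<open>W\<close> at infinity is available, so neither the integral over \<open>t\<close> nor the
  interchange of the integrals can be treated by absolute convergence. Everything is expressed
  instead through the primitive \<open>F R = \<integral>_0^R v^(s-1) W v dv\<close>, which is continuous, bounded and
  has a limit at infinity (\<open>partial_mellin\<close>). Since \<open>p^(s-1) W(p/q) = q^s d/dp F(p/q)\<close>, the Mellin integrand should
  be the derivative in \<open>p\<close> of
  \[ H(p) = \int_0^1 w(t) e^{zt} F(p/q) dt, \]
  an absolutely convergent integral with \<open>H 0 = 0\<close> and, by dominated convergence, with the
  expected limit at infinity. Once \<open>H'\<close> is known, the fundamental theorem of calculus gives both
  the convergence and the value of the Mellin transform (\<open>has_integral_mellin_beta_kernel\<close>).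

  To differentiate \<open>H\<close>, the integral over \<open>t\<close> is cut off to \<open>[\<delta>, 1-\<delta>]\<close>, where everything is
  continuous and the integrals may be swapped (\<open>truncated_mellin\<close>). The tails near \<open>0\<close> and \<open>1\<close>
  are integrated by parts: there \<open>W(p/q)\<close> is a smooth factor times the \<open>t\<close>-derivative of the
  bounded function \<open>F(p/q)\<close>, and the remaining factor, \<open>t^(b+s)\<close> or \<open>(1-t)^(c-b+s)\<close>, makes the
  tails vanish as \<open>\<delta>\<close> tends to \<open>0\<close>, uniformly for \<open>p\<close> in compact subsets of the positive axis (\<open>tail_bound\<close>).
  The same bound is linear in the \<open>C^1\<close> size of the smooth factor multiplying the Beta weight,
  which justifies summing the exponential series under the conditionally convergent integral
  (\<open>beta_kernel_exp_sums\<close>).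

  Two classical facts enter as well: the Wright series converges everywhere, so \<open>W\<close> is continuous
  (\<open>isCont_wright\<close>), and the Beta integral holds for complex parameters
  (\<open>has_integral_Beta_complex\<close>).
\<close>

section \<open>The Wright function is entire\<close>

text \<open>
  The reflection formula gives \<open>|1/\<Gamma>(1+iy)|^2 = sinh(\<pi>y)/(\<pi>y)\<close>, and \<open>sinh u \<le> u e^u\<close> for
  \<open>u \<ge> 0\<close>.
\<close>

lemma norm_rGamma_1_plus_imaginary_le: "norm (rGamma (Complex 1 y)) \<le> exp (pi * \<bar>y\<bar> / 2)"
proof (cases "y = 0")
  case True
  then have "Complex 1 y = 1" by (simp add: complex_eq_iff)
  then show ?thesis using True by simp
next
  case False
  define w where "w = Complex 0 y"
  define u where "u = pi * \<bar>y\<bar>"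
  have u: "u > 0" using False by (simp add: u_def)
  have w: "w \<noteq> 0" "norm w = \<bar>y\<bar>" "1 + w = Complex 1 y" "1 - w = cnj (Complex 1 y)" "w = \<i> * of_real y"
    using False by (auto simp: w_def complex_eq_iff cmod_def)
  have "w * (rGamma (1 + w) * rGamma (1 - w)) = sin (of_real pi * w) / of_real pi"
    using rGamma_reflection_complex[of w] rGamma_plus1[of w] by (simp add: add.commute flip: mult.assoc)
  then have "norm (w * (rGamma (1 + w) * rGamma (1 - w))) = norm (sin (of_real pi * w) / of_real pi)"
    by simp
  then have "\<bar>y\<bar> * norm (rGamma (Complex 1 y)) ^ 2 = norm (sin (of_real pi * w)) / pi"
    unfolding norm_mult w(2-4) cnj_rGamma[symmetric]
    by (simp add: norm_divide power2_eq_square mult_ac)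
  also have "norm (sin (of_real pi * w)) = \<bar>exp (- (pi * y)) - exp (pi * y)\<bar> / 2"
  proof -
    have iw: "\<i> * (of_real pi * w) = of_real (- (pi * y))" by (simp add: w_def complex_eq_iff)
    have "exp (\<i> * (of_real pi * w)) = of_real (exp (- (pi * y)))"
      unfolding iw by (rule exp_of_real)
    moreover have "exp (- (\<i> * (of_real pi * w))) = of_real (exp (pi * y))"
      unfolding iw of_real_minus[symmetric] minus_minus by (rule exp_of_real)
    ultimately have "sin (of_real pi * w) = of_real (exp (- (pi * y)) - exp (pi * y)) / (2 * \<i>)"
      unfolding sin_exp_eq of_real_diff by simp
    then show ?thesis by (simp add: norm_divide norm_mult del: of_real_diff)
  qed
  also have "\<bar>exp (- (pi * y)) - exp (pi * y)\<bar> = exp u - exp (- u)"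
    using u by (cases "y > 0") (auto simp: u_def)
  also have "\<dots> = exp u * (1 - exp (- (2 * u)))"
    by (simp add: algebra_simps flip: exp_add)
  also have "exp u * (1 - exp (- (2 * u))) / 2 / pi \<le> exp u * (2 * u) / 2 / pi"
    using exp_ge_add_one_self[of "- (2 * u)"] by (intro divide_right_mono mult_left_mono) auto
  finally have "\<bar>y\<bar> * norm (rGamma (Complex 1 y)) ^ 2 \<le> \<bar>y\<bar> * exp u"
    by (simp add: u_def mult.commute)
  then have "norm (rGamma (Complex 1 y)) ^ 2 \<le> exp (u / 2) ^ 2"
    using False by (simp add: power2_eq_square flip: exp_add)
  then have "norm (rGamma (Complex 1 y)) \<le> exp (u / 2)"
    by (rule power2_le_imp_le) simp
  then show ?thesis by (simp add: u_def)
qed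

text \<open>
  By Euler's limit formula, \<open>|rGamma (x+iy)| / |rGamma x|\<close> and \<open>|rGamma (1+iy)| / |rGamma 1|\<close> are
  limits of products of factors \<open>|a+iy|/a\<close>, with \<open>a = x+k\<close> and \<open>a = 1+k\<close> respectively, and such a
  factor decreases in \<open>a > 0\<close>.
\<close>

lemma norm_rGamma_le_vertical:
  assumes "x \<ge> 1"
  shows "norm (rGamma (Complex x y)) \<le> norm (rGamma (complex_of_real x)) * norm (rGamma (Complex 1 y))"
proof -
  have poch: "norm (pochhammer (Complex x y) n) * norm (pochhammer (1 :: complex) n) \<le>
      norm (pochhammer (complex_of_real x) n) * norm (pochhammer (Complex 1 y) n)" for n
    unfolding pochhammer_prod prod_norm[symmetric] prod.distrib[symmetric]
  proof (rule prod_mono, intro conjI)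
    fix k
    have 1: "Complex x y + of_nat k = Complex (x + k) y" "1 + of_nat k = complex_of_real (1 + k)"
      "of_real x + of_nat k = complex_of_real (x + k)" "Complex 1 y + of_nat k = Complex (1 + k) y"
      by (auto simp: complex_eq_iff)
    have "((x + k)^2 + y^2) * (1 + real k)^2 \<le> (x + k)^2 * ((1 + real k)^2 + y^2)"
    proof -
      have "(1 + real k)^2 \<le> (x + k)^2" using assms by (intro power_mono) auto
      then have "y^2 * (1 + real k)^2 \<le> y^2 * (x + k)^2" by (rule mult_left_mono) auto
      then show ?thesis by (simp add: algebra_simps)
    qed
    then have "(norm (Complex (x + k) y) * norm (complex_of_real (1 + k)))^2 \<le>
       (norm (complex_of_real (x + k)) * norm (Complex (1 + k) y))^2"
      by (simp add: power_mult_distrib cmod_power2)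
    then show "norm (Complex x y + of_nat k) * norm (1 + of_nat k :: complex) \<le>
       norm (complex_of_real x + of_nat k) * norm (Complex 1 y + of_nat k)"
      unfolding 1 by (rule power2_le_imp_le) auto
  qed auto
  have "norm (rGamma_series (Complex x y) n) * norm (rGamma_series (1::complex) n) \<le>
      norm (rGamma_series (complex_of_real x) n) * norm (rGamma_series (Complex 1 y) n)" for n
  proof -
    have norm_series: "norm (rGamma_series z n) = norm (pochhammer z (n + 1)) / (fact n * exp (Re z * ln (real n)))" for z :: complex
      by (simp add: rGamma_series_def norm_divide norm_mult)
    show ?thesis
      unfolding norm_series using poch[of "n + 1"] by (simp add: divide_simps mult_ac)
  qed
  note le = this
  have lim: "(\<lambda>n. norm (rGamma_series z n) * norm (rGamma_series w n)) \<longlonglongrightarrow> norm (rGamma z) * norm (rGamma w)"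
    for z w :: complex
    by (intro tendsto_intros)
  have "norm (rGamma (Complex x y)) * norm (rGamma (1::complex)) \<le> norm (rGamma (complex_of_real x)) * norm (rGamma (Complex 1 y))"
    by (rule LIMSEQ_le[OF lim lim]) (use le in blast)
  then show ?thesis by simp
qed

text \<open>
  A bound on \<open>[1,2]\<close> propagates to the right because \<open>rGamma (x + 1) = rGamma x / x\<close> and \<open>x \<ge> 1\<close>.
\<close>

lemma rGamma_bounded_real_ge_1:
  obtains A where "A > 0" "\<And>x. x \<ge> 1 \<Longrightarrow> norm (rGamma (complex_of_real x)) \<le> A"
proof -
  have "continuous_on {1..2} (\<lambda>x. rGamma (complex_of_real x))"
    by (rule continuous_on_compose2[OF continuous_on_rGamma[of UNIV]]) (auto intro: continuous_intros)
  from compact_imp_bounded[OF compact_continuous_image[OF this compact_Icc]]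
  obtain A where A: "A > 0" "\<And>x. x \<in> {1..2} \<Longrightarrow> norm (rGamma (complex_of_real x)) \<le> A"
    unfolding bounded_pos by (auto simp del: atLeastAtMost_iff)
  have step: "norm (rGamma (complex_of_real x)) \<le> A" if "1 \<le> x" "x \<le> 2 + real n" for n x
    using that
  proof (induction n arbitrary: x)
    case (Suc n)
    show ?case
    proof (cases "x \<le> 2")
      case False
      have "complex_of_real (x - 1) * rGamma (complex_of_real x) = rGamma (complex_of_real (x - 1))"
        using rGamma_plus1[of "complex_of_real (x - 1)"] by simp
      then have "norm (complex_of_real (x - 1) * rGamma (complex_of_real x)) = norm (rGamma (complex_of_real (x - 1)))"
        by simp
      then have "(x - 1) * norm (rGamma (complex_of_real x)) \<le> A"
        using Suc.IH[of "x - 1"] Suc.prems False by (simp add: norm_mult del: of_real_diff)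
      moreover have "norm (rGamma (complex_of_real x)) \<le> (x - 1) * norm (rGamma (complex_of_real x))"
        using False by (intro mult_le_cancel_right1[THEN iffD2]) auto
      ultimately show ?thesis by simp
    qed (use A Suc.prems in auto)
  qed (use A in auto)
  show ?thesis
  proof (rule that[OF A(1)])
    fix x :: real assume "x \<ge> 1"
    moreover obtain n where "x \<le> real n" using real_arch_simple by blast
    ultimately show "norm (rGamma (complex_of_real x)) \<le> A" using step[of x n] by simp
  qed
qed

lemma norm_pochhammer_le: "norm (pochhammer (w::complex) m) \<le> (norm w + real m) ^ m"
proof -
  have "norm (pochhammer w m) = (\<Prod>k<m. norm (w + of_nat k))"
    by (simp add: pochhammer_prod prod_norm atLeast0LessThan)
  also have "\<dots> \<le> (\<Prod>k<m. norm w + real m)"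
  proof (rule prod_mono, intro conjI)
    fix k assume "k \<in> {..<m}"
    then show "norm (w + of_nat k) \<le> norm w + real m"
      using norm_triangle_ineq[of w "of_nat k"] by simp
  qed auto
  finally show ?thesis by simp
qed

text \<open>
  The shift \<open>m\<close> moves \<open>w\<close> into the half plane \<open>Re \<ge> 1\<close>, where \<open>rGamma\<close> grows at most
  exponentially in \<open>|Im w|\<close>. The price is a Pochhammer factor, and the number \<open>m\<close> of its factors
  is what decides the growth of \<open>rGamma (\<alpha> n + \<beta>)\<close>.
\<close>

lemma norm_rGamma_shift_bound:
  obtains A where "A > 0" "\<And>w m. Re w + real m \<ge> 1 \<Longrightarrow>
    norm (rGamma w) \<le> A * (norm w + real m) ^ m * exp (2 * norm w)"
proof -
  obtain A where A: "A > 0" "\<And>x. x \<ge> 1 \<Longrightarrow> norm (rGamma (complex_of_real x)) \<le> A"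
    using rGamma_bounded_real_ge_1 by blast
  show ?thesis
  proof (rule that[OF A(1)])
    fix w m assume wm: "Re w + real m \<ge> 1"
    have "norm (rGamma (w + of_nat m)) \<le> A * exp (pi * \<bar>Im w\<bar> / 2)"
    proof -
      have "w + of_nat m = Complex (Re w + m) (Im w)" by (simp add: complex_eq_iff)
      then have "norm (rGamma (w + of_nat m)) \<le> norm (rGamma (complex_of_real (Re w + m))) * norm (rGamma (Complex 1 (Im w)))"
        using norm_rGamma_le_vertical[OF wm] by simp
      also have "\<dots> \<le> A * exp (pi * \<bar>Im w\<bar> / 2)"
        using A(1) by (intro mult_mono A(2)[OF wm] norm_rGamma_1_plus_imaginary_le) auto
      finally show ?thesis .
    qed
    also have "\<dots> \<le> A * exp (2 * norm w)"
    proof -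
      have "pi * \<bar>Im w\<bar> \<le> 4 * norm w"
        using pi_less_4 abs_Im_le_cmod[of w] by (intro mult_mono) auto
      then show ?thesis using A by (intro mult_left_mono) auto
    qed
    finally have "norm (rGamma (w + of_nat m)) \<le> A * exp (2 * norm w)" .
    then have "norm (rGamma w) \<le> (norm w + real m) ^ m * (A * exp (2 * norm w))"
      unfolding pochhammer_rGamma[of w m] norm_mult by (intro mult_mono norm_pochhammer_le) auto
    then show "norm (rGamma w) \<le> A * (norm w + real m) ^ m * exp (2 * norm w)" by (simp add: mult_ac)
  qed
qed

lemma power_div_fact_le_exp: "real n ^ n / fact n \<le> exp (real n)"
proof -
  have s: "(\<lambda>k. real n ^ k / fact k) sums exp (real n)"
    using exp_converges[of "real n"] by (simp add: divide_inverse mult.commute)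
  have "(\<Sum>k\<in>{n}. real n ^ k / fact k) \<le> (\<Sum>k. real n ^ k / fact k)"
    using s by (intro sum_le_suminf) (auto simp: sums_iff)
  then show ?thesis using s by (simp add: sums_iff)
qed

text \<open>
  With \<open>a = max 0 (- Re \<alpha>) < 1\<close>, about \<open>a n\<close> shifts bring \<open>\<alpha> n + \<beta>\<close> into the half plane
  \<open>Re \<ge> 1\<close>, so \<open>rGamma (\<alpha> n + \<beta>)\<close> is at most \<open>n^(a n)\<close> up to exponential factors, which the
  \<open>n^n\<close> in \<open>n!\<close> beats.
\<close>

lemma summable_wright:
  assumes "Re \<alpha> > -1"
  shows "summable (\<lambda>n. rGamma (\<alpha> * of_nat n + \<beta>) * z ^ n / fact n)"
proof -
  obtain A where A: "A > 0" "\<And>w m. Re w + real m \<ge> 1 \<Longrightarrow>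
    norm (rGamma w) \<le> A * (norm w + real m) ^ m * exp (2 * norm w)"
    using norm_rGamma_shift_bound by blast
  define a where "a = max 0 (- Re \<alpha>)"
  have a: "0 \<le> a" "a < 1" "- Re \<alpha> \<le> a" using assms by (auto simp: a_def)
  define b where "b = norm \<beta> + 2"
  define L where "L = norm \<alpha> + 1 + 2 * b"
  define r where "r = norm z + 1"
  have L: "L > 1" "b \<ge> 2" "r > 0"
    by (simp_all add: L_def b_def r_def add_pos_nonneg add_nonneg_pos)
  define B where "B = (\<lambda>n::nat. A * (L * (real n + 1)) powr (a * real n + b) * exp (2 * (L * (real n + 1))) * r powr real n * exp (real n) / real n powr real n)"
  have bound: "norm (rGamma (\<alpha> * of_nat n + \<beta>) * z ^ n / fact n) \<le> B n" if n: "n > 0" for n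
  proof -
    define w where "w = \<alpha> * of_nat n + \<beta>"
    define q where "q = a * real n + norm \<beta> + 1"
    define m where "m = nat \<lceil>q\<rceil>"
    have "q \<ge> 0" using a(1) by (simp add: q_def)
    then have "real m = of_int \<lceil>q\<rceil>" unfolding m_def by (intro of_nat_nat) simp
    then have m: "real m \<ge> a * real n + norm \<beta> + 1" "real m \<le> a * real n + b"
      using ceiling_correct[of q] unfolding b_def q_def by linarith+
    have "Re w \<ge> - a * real n - norm \<beta>"
    proof -
      have "- Re \<alpha> * real n \<le> a * real n" using a by (intro mult_right_mono) auto
      moreover have "Re w = Re \<alpha> * real n + Re \<beta>" by (simp add: w_def)
      moreover have "- Re \<beta> \<le> norm \<beta>" using abs_Re_le_cmod[of \<beta>] by linarith
      ultimately show ?thesis by simp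
    qed
    with m have "Re w + real m \<ge> 1" by simp
    from A(2)[OF this] have 1: "norm (rGamma w) \<le> A * (norm w + real m) ^ m * exp (2 * norm w)" .
    have nw: "norm w \<le> norm \<alpha> * real n + norm \<beta>"
      using norm_triangle_ineq[of "\<alpha> * of_nat n" \<beta>] by (simp add: w_def norm_mult)
    have an: "a * real n \<le> real n" using a by (intro mult_left_le_one_le) auto
    have X: "norm w + real m \<le> L * (real n + 1)"
    proof -
      have "norm w + real m \<le> norm \<alpha> * real n + norm \<beta> + (real n + b)" using nw m an by simp
      also have "\<dots> \<le> L * (real n + 1)"
        using L by (simp add: L_def b_def algebra_simps add_nonneg_nonneg)
      finally show ?thesis .
    qed
    have X1: "L * (real n + 1) \<ge> 1" using mult_mono[of 1 L 1 "real n + 1"] L by simp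
    have "(norm w + real m) ^ m \<le> (L * (real n + 1)) ^ m"
      using X by (intro power_mono) auto
    also have "\<dots> = (L * (real n + 1)) powr real m"
      using X1 by (subst powr_realpow) auto
    also have "\<dots> \<le> (L * (real n + 1)) powr (a * real n + b)"
      using X1 m by (intro powr_mono) auto
    finally have 2: "(norm w + real m) ^ m \<le> (L * (real n + 1)) powr (a * real n + b)" .
    have 3: "exp (2 * norm w) \<le> exp (2 * (L * (real n + 1)))" using X by simp
    have 4: "norm (rGamma w) \<le> A * (L * (real n + 1)) powr (a * real n + b) * exp (2 * (L * (real n + 1)))"
      using 1 by (rule order_trans) (intro mult_mono 2 3, use A in auto)
    have 5: "norm z ^ n \<le> r powr real n"
      using L by (subst powr_realpow) (auto simp: r_def intro!: power_mono)
    have 6: "1 / fact n \<le> exp (real n) / real n powr real n"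
      using power_div_fact_le_exp[of n] n by (simp add: powr_realpow field_simps)
    have "norm (rGamma w * z ^ n / fact n) = norm (rGamma w) * norm z ^ n * (1 / fact n)"
      by (simp add: norm_mult norm_divide norm_power)
    also have "\<dots> \<le> A * (L * (real n + 1)) powr (a * real n + b) * exp (2 * (L * (real n + 1))) * r powr real n *
        (exp (real n) / real n powr real n)"
      using A L by (intro mult_mono 4 5 6) auto
    finally show ?thesis by (simp add: w_def B_def)
  qed
  \<comment> \<open>Up to an additive constant, \<open>E n\<close> is the logarithm of \<open>B n * 2^n\<close>; its leading term is \<open>(a - 1) n ln n\<close>.\<close>
  define E where "E = (\<lambda>n::nat. (a * real n + b) * ln (L * (real n + 1)) + (2 * L + ln r + 1 + ln 2) * real n
      - real n * ln (real n))"
  have "filterlim E at_bot at_top"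
    unfolding E_def using a(2) L(1) by real_asymp
  then have "((\<lambda>n. (A * exp (2 * L)) * exp (E n)) \<longlongrightarrow> (A * exp (2 * L)) * 0) at_top"
    by (intro tendsto_intros filterlim_compose[OF exp_at_bot])
  then have lim: "((\<lambda>n. (A * exp (2 * L)) * exp (E n)) \<longlongrightarrow> 0) at_top" by simp
  have eq: "(A * exp (2 * L)) * exp (E n) = B n * 2 powr real n" if "n > 0" for n
  proof -
    have "L * (real n + 1) \<noteq> 0" using L(1) by auto
    then show ?thesis
      using L(3) that unfolding B_def E_def powr_def exp_add exp_diff distrib_left distrib_right
      by (simp add: mult_ac exp_add)
  qed
  have "((\<lambda>n. B n * 2 powr real n) \<longlongrightarrow> 0) at_top"
    by (rule Lim_transform_eventually[OF lim]) (rule eventually_mono[OF eventually_gt_at_top[of 0] eq])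
  then have ev: "\<forall>\<^sub>F n in sequentially. B n * 2 powr real n < 1"
    by (rule order_tendstoD) simp
  show ?thesis
  proof (rule summable_comparison_test_ev)
    show "\<forall>\<^sub>F n in sequentially. norm (rGamma (\<alpha> * of_nat n + \<beta>) * z ^ n / fact n) \<le> (1/2) ^ n"
      using ev eventually_gt_at_top[of 0]
    proof eventually_elim
      case (elim n)
      have "norm (rGamma (\<alpha> * of_nat n + \<beta>) * z ^ n / fact n) * 2 ^ n \<le> B n * 2 ^ n"
        using elim by (intro mult_right_mono bound) auto
      also have "\<dots> \<le> 1" using elim by (simp add: powr_realpow)
      finally show ?case by (simp only: power_one_over pos_le_divide_eq zero_less_power zero_less_numeral)
    qed
    show "summable (\<lambda>n. (1/2::real) ^ n)" by (rule summable_geometric) simp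
  qed
qed

lemma isCont_wright:
  assumes "Re \<alpha> > -1"
  shows "isCont (wright \<alpha> \<beta>) z"
proof -
  have "summable (\<lambda>n. rGamma (\<alpha> * of_nat n + \<beta>) / fact n * z ^ n)" for z
    using summable_wright[OF assms, of \<beta> z] by simp
  from isCont_powser_converges_everywhere[OF this] show ?thesis
    by (simp add: wright_def[abs_def])
qed

section \<open>The Beta integral for complex parameters\<close>

text \<open>
  The integrand of the Gamma integral, extended by \<open>0\<close> to the left half line. The extension makes
  the product \<open>gamma_weight x u * gamma_weight y (r - u)\<close> below vanish outside \<open>0 < u < r\<close>.
\<close>

definition gamma_weight :: "complex \<Rightarrow> real \<Rightarrow> complex" where
  "gamma_weight x t = (if t > 0 then exp ((x - 1) * of_real (ln t) - of_real t) else 0)"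

lemma gamma_weight_eq: "t > 0 \<Longrightarrow> gamma_weight x t = of_real t powr (x - 1) / of_real (exp t)"
  by (simp add: gamma_weight_def powr_def Ln_of_real exp_diff exp_of_real)

lemma gamma_weight_measurable [measurable]: "gamma_weight x \<in> borel_measurable borel"
proof -
  have [measurable]: "(exp :: complex \<Rightarrow> complex) \<in> borel_measurable borel"
    by (intro borel_measurable_continuous_onI continuous_intros)
  show ?thesis unfolding gamma_weight_def[abs_def] by measurable
qed

lemma gamma_weight_integral:
  assumes "Re x > 0"
  shows "integrable lborel (gamma_weight x)" "integral\<^sup>L lborel (gamma_weight x) = Gamma x"
proof -
  have eq: "indicator {0<..} t *\<^sub>R (of_real t powr (x - 1) / of_real (exp t)) = gamma_weight x t" for t
    by (auto simp: indicator_def gamma_weight_eq) (auto simp: gamma_weight_def)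
  have si: "set_integrable lebesgue {0<..} (\<lambda>t. of_real t powr (x - 1) / of_real (exp t))"
    by (rule absolutely_integrable_Gamma_integral'[OF assms])
  then have "integrable lebesgue (gamma_weight x)"
    unfolding set_integrable_def eq .
  then show "integrable lborel (gamma_weight x)"
    by (subst (asm) integrable_completion) auto
  have "Gamma x = integral {0<..} (\<lambda>t. of_real t powr (x - 1) / of_real (exp t))"
    using Gamma_integral_complex'[OF assms] by (simp add: integral_unique)
  also have "\<dots> = integral\<^sup>L lebesgue (gamma_weight x)"
    using set_lebesgue_integral_eq_integral(2)[OF si] unfolding set_lebesgue_integral_def eq by simp
  also have "\<dots> = integral\<^sup>L lborel (gamma_weight x)"
    by (rule integral_completion) simp
  finally show "integral\<^sup>L lborel (gamma_weight x) = Gamma x" by simp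
qed

lemma nonpos_Ints_Re_pos: "Re x > 0 \<Longrightarrow> x \<notin> \<int>\<^sub>\<le>\<^sub>0"
  by (auto elim!: nonpos_Ints_cases)

text \<open>
  The convolution of the weights of \<open>\<Gamma>(x)\<close> and \<open>\<Gamma>(y)\<close> is, by the substitution \<open>u = r t\<close>, the
  weight of \<open>\<Gamma>(x+y)\<close> times the Beta integral \<open>I\<close>; the integral of a convolution is the product of
  the integrals, so \<open>\<Gamma>(x+y) I = \<Gamma>(x) \<Gamma>(y)\<close>.
\<close>

theorem has_integral_Beta_complex:
  assumes x: "Re x > 0" and y: "Re y > 0"
  shows "((\<lambda>t. of_real t powr (x - 1) * of_real (1 - t) powr (y - 1)) has_integral Beta x y) {0..1}"
proof -
  define \<beta> where "\<beta> = (\<lambda>t::real. complex_of_real t powr (x - 1) * of_real (1 - t) powr (y - 1))"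
  define I where "I = (\<integral>t. indicator {0<..<1} t *\<^sub>R \<beta> t \<partial>lborel)"
  define f where "f = (\<lambda>(u, r). gamma_weight x u * gamma_weight y (r - u))"
  have f_meas: "f \<in> borel_measurable (lborel \<Otimes>\<^sub>M lborel)"
    unfolding f_def by measurable
  have shift_int: "integrable lborel (\<lambda>r. gamma_weight y (r - u))" for u
    using lborel_integrable_real_affine[OF gamma_weight_integral(1)[OF y], of 1 "-u"] by simp
  have shift: "(\<integral>r. gamma_weight y (r - u) \<partial>lborel) = Gamma y" for u
    using lborel_integral_real_affine[of 1 "gamma_weight y" "-u"] gamma_weight_integral(2)[OF y] by simp
  have shift_norm: "(\<integral>r. norm (gamma_weight y (r - u)) \<partial>lborel) = (\<integral>r. norm (gamma_weight y r) \<partial>lborel)" for u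
    using lborel_integral_real_affine[of 1 "\<lambda>r. norm (gamma_weight y r)" "-u"] by simp
  \<comment> \<open>The double integral of the norm is a product of two absolutely convergent Gamma integrals.\<close>
  have f_int: "integrable (lborel \<Otimes>\<^sub>M lborel) f"
  proof (rule lborel_pair.Fubini_integrable[OF f_meas])
    show "integrable lborel (\<lambda>u. \<integral>r. norm (f (u, r)) \<partial>lborel)"
      using gamma_weight_integral(1)[OF x] by (simp add: f_def norm_mult shift_norm)
    show "AE u in lborel. integrable lborel (\<lambda>r. f (u, r))"
      using shift_int by (simp add: f_def)
  qed
  have rescale: "(\<integral>u. f (u, r) \<partial>lborel) = gamma_weight (x + y) r * I" for r
  proof (cases "r > 0")
    case False
    then have "f (u, r) = 0" for u by (auto simp: f_def gamma_weight_def)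
    then show ?thesis using False by (simp add: gamma_weight_def)
  next
    case True
    have "(\<integral>u. f (u, r) \<partial>lborel) = r *\<^sub>R (\<integral>t. f (r * t, r) \<partial>lborel)"
      using lborel_integral_real_affine[of r "\<lambda>u. f (u, r)" 0] True by simp
    also have "(\<integral>t. f (r * t, r) \<partial>lborel) = (\<integral>t. (gamma_weight (x + y) r / of_real r) * (indicator {0<..<1} t *\<^sub>R \<beta> t) \<partial>lborel)"
    proof (rule Bochner_Integration.integral_cong[OF refl])
      fix t :: real
      show "f (r * t, r) = (gamma_weight (x + y) r / of_real r) * (indicator {0<..<1} t *\<^sub>R \<beta> t)"
      proof (cases "t \<in> {0<..<1}")
        case False
        then have "r * t \<le> 0 \<or> r - r * t \<le> 0" using True by (auto simp: mult_le_0_iff)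
        then show ?thesis using False by (auto simp: f_def gamma_weight_def)
      next
        case t: True
        then have pos: "r * t > 0" "r - r * t > 0" "0 < 1 - t" "0 < t" using True by auto
        \<comment> \<open>The three powers of \<open>r\<close> combine: \<open>(x-1) + (y-1) = (x+y-1) - 1\<close>, which leaves the factor \<open>1/r\<close>.\<close>
        have ln: "ln (r * t) = ln r + ln t" "ln (r - r * t) = ln r + ln (1 - t)"
          using True t ln_mult[of r "1 - t"] by (auto simp: ln_mult algebra_simps)
        have "f (r * t, r) = exp ((x - 1) * of_real (ln (r * t)) - of_real (r * t)) * exp ((y - 1) * of_real (ln (r - r * t)) - of_real (r - r * t))"
          using pos by (simp add: f_def gamma_weight_def)
        also have "\<dots> = exp ((x + y - 1) * of_real (ln r) - of_real r) * exp (- of_real (ln r)) *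
            (exp ((x - 1) * of_real (ln t)) * exp ((y - 1) * of_real (ln (1 - t))))"
          unfolding ln by (simp add: algebra_simps flip: exp_add)
        also have "exp (- complex_of_real (ln r)) = 1 / of_real r"
          using True by (simp add: exp_minus exp_of_real inverse_eq_divide)
        finally show ?thesis
          using t True pos by (simp add: gamma_weight_def \<beta>_def powr_def Ln_of_real del: of_real_diff)
      qed
    qed
    also have "\<dots> = (gamma_weight (x + y) r / of_real r) * I"
      unfolding I_def by (rule integral_mult_right_zero)
    finally show ?thesis using True by (simp add: scaleR_conv_of_real)
  qed
  have "Gamma (x + y) * I = (\<integral>r. (\<integral>u. f (u, r) \<partial>lborel) \<partial>lborel)"
    unfolding rescale using gamma_weight_integral[of "x + y"] x y by simp
  also have "\<dots> = (\<integral>u. (\<integral>r. f (u, r) \<partial>lborel) \<partial>lborel)"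
    using lborel_pair.Fubini_integral[of "\<lambda>u r. f (u, r)"] f_int by simp
  also have "\<dots> = Gamma x * Gamma y"
    using gamma_weight_integral[OF x] by (simp add: f_def shift)
  finally have "Gamma (x + y) * I = Gamma x * Gamma y" .
  moreover have "Gamma (x + y) \<noteq> 0"
    using x y by (simp add: Gamma_eq_zero_iff nonpos_Ints_Re_pos)
  ultimately have I: "I = Beta x y" by (simp add: Beta_def field_simps)
  have "set_integrable lborel {0<..<1} \<beta>"
    unfolding set_integrable_def
  proof (rule Bochner_Integration.integrable_bound)
    show "integrable lborel (\<lambda>t. indicator {0..1} t *\<^sub>R (t powr (Re x - 1) * (1 - t) powr (Re y - 1)))"
      using integrable_Beta[OF x y] unfolding set_integrable_def .
    have "continuous_on {0<..<1} \<beta>"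
      unfolding \<beta>_def by (intro continuous_intros) (auto simp: complex_nonpos_Reals_iff)
    then show "(\<lambda>t. indicator {0<..<1} t *\<^sub>R \<beta> t) \<in> borel_measurable lborel"
      by (simp add: borel_measurable_continuous_on_indicator)
    show "AE t in lborel. norm (indicator {0<..<1} t *\<^sub>R \<beta> t) \<le>
        norm (indicator {0..1} t *\<^sub>R (t powr (Re x - 1) * (1 - t) powr (Re y - 1)))"
      by (auto simp: indicator_def \<beta>_def norm_mult norm_powr_real_powr simp del: of_real_diff)
  qed
  from set_borel_integral_eq_integral[OF this] have "(\<beta> has_integral I) {0<..<1}"
    unfolding I_def set_lebesgue_integral_def[symmetric] by (simp add: has_integral_iff)
  then show ?thesis unfolding I \<beta>_def by (simp add: has_integral_Icc_iff_Ioo)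
qed

lemma Beta_add_of_nat:
  assumes "Re x > 0" "Re y > 0"
  shows "Beta (x + of_nat n) y = Beta x y * (pochhammer x n / pochhammer (x + y) n)"
proof -
  have nz: "Gamma x \<noteq> 0" "Gamma (x + y) \<noteq> 0" "Gamma (x + y + of_nat n) \<noteq> 0"
    using assms by (simp_all add: Gamma_eq_zero_iff nonpos_Ints_Re_pos)
  show ?thesis
    using nz assms by (simp add: pochhammer_Gamma nonpos_Ints_Re_pos Beta_def add_ac)
qed

section \<open>Improper integrals and integration by parts\<close>

text \<open>
  For a Henstock-Kurzweil integral over a half line, convergence means exactly that the integrals
  over large compact intervals converge, also in the absence of absolute convergence. The converse
  direction is \<open>has_integral_improper\<close> below.
\<close>

lemma improper_integral_tendsto:
  fixes f :: "real \<Rightarrow> 'a::banach"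
  assumes "f integrable_on {0..}"
  shows "((\<lambda>R. integral {0..R} f) \<longlongrightarrow> integral {0..} f) at_top"
proof (rule tendstoI)
  fix e :: real assume "e > 0"
  have "(f has_integral integral {0..} f) {0..}"
    using assms by (rule integrable_integral)
  then obtain B where B: "B > 0" "\<And>a b. ball 0 B \<subseteq> cbox a b \<Longrightarrow>
      norm (integral (cbox a b) (\<lambda>x. if x \<in> {0..} then f x else 0) - integral {0..} f) < e"
    unfolding has_integral_alt'[of f] using \<open>e > 0\<close> by metis
  have "dist (integral {0..R} f) (integral {0..} f) < e" if "R \<ge> B" for R
  proof -
    have "ball 0 B \<subseteq> cbox (-R) R" using that by (auto simp: dist_norm)
    moreover have "{0..} \<inter> {-R..R} = {0..R}" "max 0 (-R) = 0" "0 \<le> R" using that B(1) by auto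
    ultimately show ?thesis
      using B(2)[of "-R" R] integral_restrict_Int[of "{-R..R}" "{0..}" f]
      by (simp add: dist_norm Int_commute)
  qed
  then show "\<forall>\<^sub>F R in at_top. dist (integral {0..R} f) (integral {0..} f) < e"
    unfolding eventually_at_top_linorder by blast
qed

lemma has_integral_Icc_iff_Ioc:
  fixes f :: "real \<Rightarrow> 'a::banach"
  shows "(f has_integral I) {a..b} \<longleftrightarrow> (f has_integral I) {a<..b}"
  by (rule has_integral_spike_set_eq) (rule negligible_subset[of "{a}"]; force)+

lemma has_vector_derivative_of_real_powr:
  assumes "t > 0"
  shows "((\<lambda>t. complex_of_real t powr a) has_vector_derivative a * of_real t powr (a - 1)) (at t within S)"
proof -
  have "((\<lambda>u. u powr a) has_field_derivative a * of_real t powr (a - 1)) (at (complex_of_real t))"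
    using assms by (intro has_field_derivative_powr) (auto simp: complex_nonpos_Reals_iff)
  from has_vector_derivative_real_field[OF this] show ?thesis by simp
qed

text \<open>
  Only a bound on \<open>U\<close> itself is required, not on its derivative: after integrating by parts, \<open>U\<close>
  appears multiplied by the derivative of \<open>t^\<xi> \<Phi>(t)\<close>, which is of order \<open>t^(Re \<xi> - 1)\<close> and hence
  absolutely integrable. The boundary term at \<open>0\<close> vanishes since \<open>Re \<xi> > 0\<close>. It is applied to
  functions \<open>U\<close> whose derivative need not be absolutely integrable near \<open>0\<close>.
\<close>

lemma integration_by_parts_bound:
  fixes \<Phi> U :: "real \<Rightarrow> complex"
  assumes \<xi>: "Re \<xi> > 0" and \<delta>: "0 < \<delta>" "\<delta> \<le> 1"
    and \<Phi>: "\<And>t. t \<in> {0..\<delta>} \<Longrightarrow> (\<Phi> has_vector_derivative \<Phi>' t) (at t)"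
    and \<Phi>'_cont: "continuous_on {0..\<delta>} \<Phi>'"
    and N: "\<And>t. t \<in> {0..\<delta>} \<Longrightarrow> norm (\<Phi> t) \<le> N \<and> norm (\<Phi>' t) \<le> N"
    and U: "\<And>t. t \<in> {0<..\<delta>} \<Longrightarrow> (U has_vector_derivative U' t) (at t)"
    and K: "\<And>t. t \<in> {0<..\<delta>} \<Longrightarrow> norm (U t) \<le> K"
  defines "f \<equiv> \<lambda>t. of_real t powr \<xi> * \<Phi> t * U' t"
  shows "f integrable_on {0..\<delta>}"
    and "norm (integral {0..\<delta>} f) \<le> K * N * ((norm \<xi> + 1) / Re \<xi> + 1) * \<delta> powr Re \<xi>"
proof -
  define G where "G = (\<lambda>t::real. of_real t powr \<xi> * \<Phi> t)"
  define G' where "G' = (\<lambda>t::real. of_real t powr \<xi> * \<Phi>' t + \<xi> * of_real t powr (\<xi> - 1) * \<Phi> t)"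
  have N0: "N \<ge> 0" using N[of \<delta>] \<delta> norm_ge_zero order_trans by (metis atLeastAtMost_iff less_le_not_le order_refl)
  have K0: "K \<ge> 0" using K[of \<delta>] \<delta> by (metis greaterThanAtMost_iff norm_ge_zero order_refl order_trans)
  have G: "(G has_vector_derivative G' t) (at t)" if "t \<in> {0<..\<delta>}" for t
    unfolding G_def G'_def using that
    by (intro has_vector_derivative_mult has_vector_derivative_of_real_powr \<Phi>) auto
  have normG: "norm (G t) \<le> N * t powr Re \<xi>" if "t \<in> {0<..\<delta>}" for t
  proof -
    have "norm (G t) = t powr Re \<xi> * norm (\<Phi> t)"
      using that by (simp add: G_def norm_mult norm_powr_real_powr)
    then show ?thesis using N[of t] that by (simp add: mult.commute mult_left_mono)
  qed
  have normG': "norm (G' t) \<le> N * (norm \<xi> + 1) * t powr (Re \<xi> - 1)" if "t \<in> {0<..\<delta>}" for t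
  proof -
    have "norm (G' t) \<le> t powr Re \<xi> * norm (\<Phi>' t) + norm \<xi> * t powr (Re \<xi> - 1) * norm (\<Phi> t)"
      using that by (auto simp: G'_def norm_mult norm_powr_real_powr intro: order_trans[OF norm_triangle_ineq])
    also have "\<dots> \<le> t powr (Re \<xi> - 1) * N + norm \<xi> * t powr (Re \<xi> - 1) * N"
      using N[of t] that \<delta> N0
      by (intro add_mono mult_mono powr_mono') auto
    finally show ?thesis by (simp add: algebra_simps)
  qed
  have contU: "continuous_on {0<..\<delta>} U"
    using U by (meson continuous_at_imp_continuous_on has_vector_derivative_continuous)
  have contG: "continuous_on {0<..\<delta>} G"
    using G by (meson continuous_at_imp_continuous_on has_vector_derivative_continuous)
  have contPhi: "continuous_on {0..\<delta>} \<Phi>"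
    using \<Phi> by (meson continuous_at_imp_continuous_on has_vector_derivative_continuous)
  have contG': "continuous_on {0<..\<delta>} G'"
    unfolding G'_def
    by (intro continuous_intros continuous_on_subset[OF \<Phi>'_cont] continuous_on_subset[OF contPhi])
       (auto simp: complex_nonpos_Reals_iff)
  have cont0: "continuous_on {0..\<delta>} (\<lambda>t. G t * U t)"
    unfolding continuous_on_eq_continuous_within
  proof
    fix t assume t: "t \<in> {0..\<delta>}"
    show "continuous (at t within {0..\<delta>}) (\<lambda>t. G t * U t)"
    proof (cases "t = 0")
      case False
      with t have "t \<in> {0<..\<delta>}" by auto
      then show ?thesis
        using has_vector_derivative_continuous[OF has_vector_derivative_mult[OF G U]]
          continuous_at_imp_continuous_within by blast
    next
      case True
      have "((\<lambda>t. G t * U t) \<longlongrightarrow> 0) (at 0 within {0..\<delta>})"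
      proof (rule Lim_null_comparison)
        show "\<forall>\<^sub>F t in at 0 within {0..\<delta>}. norm (G t * U t) \<le> N * t powr Re \<xi> * K"
        proof -
          have "norm (G t * U t) \<le> N * t powr Re \<xi> * K" if "t \<in> {0..\<delta>}" "t \<noteq> 0" for t
            unfolding norm_mult using normG[of t] K[of t] that N0 by (intro mult_mono) auto
          then show ?thesis
            using eventually_at_filter by (force simp: eventually_at_filter)
        qed
        have "continuous_on {0..\<delta>} (\<lambda>t::real. t powr Re \<xi>)"
          using \<xi> by (intro continuous_on_powr') (auto intro!: continuous_intros)
        then have "((\<lambda>t::real. t powr Re \<xi>) \<longlongrightarrow> 0 powr Re \<xi>) (at 0 within {0..\<delta>})"
          using \<delta> by (intro continuous_on_def[THEN iffD1, rule_format]) auto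
        from tendsto_mult[OF tendsto_mult[OF tendsto_const this] tendsto_const]
        show "((\<lambda>t. N * t powr Re \<xi> * K) \<longlongrightarrow> 0) (at 0 within {0..\<delta>})" by (auto dest: meta_spec)
      qed
      then show ?thesis by (simp add: True continuous_within G_def)
    qed
  qed
  have hasint: "((\<lambda>t. G t * U' t + G' t * U t) has_integral (G \<delta> * U \<delta> - G 0 * U 0)) {0..\<delta>}"
    using \<delta> G U by (intro fundamental_theorem_of_calculus_interior cont0 has_vector_derivative_mult) auto
  have powint: "((\<lambda>t. K * N * (norm \<xi> + 1) * t powr (Re \<xi> - 1)) has_integral
      (K * N * (norm \<xi> + 1) * (\<delta> powr Re \<xi> / Re \<xi>))) {0..\<delta>}"
    using has_integral_powr_from_0[of "Re \<xi> - 1" \<delta>] \<xi> \<delta> by (intro has_integral_mult_right) auto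
  have bnd: "norm (G' t * U t) \<le> K * N * (norm \<xi> + 1) * t powr (Re \<xi> - 1)" if "t \<in> {0<..\<delta>}" for t
  proof -
    have "norm (G' t * U t) \<le> (N * (norm \<xi> + 1) * t powr (Re \<xi> - 1)) * K"
      unfolding norm_mult using normG' K that N0 by (intro mult_mono) auto
    then show ?thesis by (simp add: algebra_simps)
  qed
  have meas: "(\<lambda>t. G' t * U t) \<in> borel_measurable (lebesgue_on {0<..\<delta>})"
    by (intro continuous_imp_measurable_on_sets_lebesgue continuous_intros contU contG') auto
  note powint' = powint[unfolded has_integral_Icc_iff_Ioc]
  have "(\<lambda>t. G' t * U t) integrable_on {0<..\<delta>}"
    by (rule measurable_bounded_by_integrable_imp_integrable
          [OF meas has_integral_integrable[OF powint']]) (use bnd in auto)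
  then have int2: "(\<lambda>t. G' t * U t) integrable_on {0..\<delta>}"
    unfolding integrable_on_def has_integral_Icc_iff_Ioc .
  have f: "f = (\<lambda>t. (G t * U' t + G' t * U t) - G' t * U t)" by (simp add: f_def G_def)
  have hi: "(f has_integral (G \<delta> * U \<delta> - integral {0..\<delta>} (\<lambda>t. G' t * U t))) {0..\<delta>}"
    unfolding f using has_integral_diff[OF hasint integrable_integral[OF int2]] by (simp add: G_def)
  then show "f integrable_on {0..\<delta>}" by blast
  have "norm (integral {0<..\<delta>} (\<lambda>t. G' t * U t)) \<le> K * N * (norm \<xi> + 1) * (\<delta> powr Re \<xi> / Re \<xi>)"
    by (rule integral_norm_bound_integral'[OF bnd meas _ powint']) auto
  moreover have "integral {0<..\<delta>} (\<lambda>t. G' t * U t) = integral {0..\<delta>} (\<lambda>t. G' t * U t)"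
    using integrable_integral[OF int2] unfolding has_integral_Icc_iff_Ioc by (rule integral_unique)
  moreover have "norm (G \<delta> * U \<delta>) \<le> N * \<delta> powr Re \<xi> * K"
    unfolding norm_mult using normG[of \<delta>] K[of \<delta>] \<delta> N0 by (intro mult_mono) auto
  ultimately have "norm (integral {0..\<delta>} f) \<le> N * \<delta> powr Re \<xi> * K + K * N * (norm \<xi> + 1) * (\<delta> powr Re \<xi> / Re \<xi>)"
    using integral_unique[OF hi] norm_triangle_ineq4[of "G \<delta> * U \<delta>" "integral {0..\<delta>} (\<lambda>t. G' t * U t)"] by simp
  then show "norm (integral {0..\<delta>} f) \<le> K * N * ((norm \<xi> + 1) / Re \<xi> + 1) * \<delta> powr Re \<xi>"
    by (simp add: algebra_simps add_divide_distrib)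
qed

lemma has_integral_improper:
  fixes f :: "real \<Rightarrow> 'a::banach"
  assumes f: "\<And>b. b \<ge> 0 \<Longrightarrow> (f has_integral I b) {0..b}" and I: "(I \<longlongrightarrow> J) at_top"
  shows "(f has_integral J) {0..}"
  unfolding has_integral_alt'[of f]
proof (intro conjI allI impI)
  have inter: "{0..} \<inter> cbox a b = {max 0 a..b}" for a b :: real by auto
  show "(\<lambda>x. if x \<in> {0..} then f x else 0) integrable_on cbox a b" for a b
    unfolding integrable_restrict_Int inter
    by (rule integrable_on_subinterval[OF has_integral_integrable[OF f[of "max 0 b"]]]) auto
  fix e :: real assume "e > 0"
  from tendstoD[OF I this] obtain B where B: "\<And>b. b \<ge> B \<Longrightarrow> dist (I b) J < e"
    unfolding eventually_at_top_linorder by blast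
  show "\<exists>B>0. \<forall>a b. ball 0 B \<subseteq> cbox a b \<longrightarrow>
           norm (integral (cbox a b) (\<lambda>x. if x \<in> {0..} then f x else 0) - J) < e"
  proof (intro exI[of _ "max 1 B"] conjI allI impI)
    fix a b :: real assume sub: "ball 0 (max 1 B) \<subseteq> cbox a b"
    have "{-(max 1 B)<..<max 1 B} \<subseteq> {a..b}" using sub by (simp add: ball_eq_greaterThanLessThan)
    then have "a \<le> - (max 1 B)" "b \<ge> max 1 B"
      by (subst (asm) greaterThanLessThan_subseteq_atLeastAtMost_iff; auto)+
    then have ab: "b \<ge> 0" "b \<ge> B" "max 0 a = 0" by auto
    show "norm (integral (cbox a b) (\<lambda>x. if x \<in> {0..} then f x else 0) - J) < e"
      unfolding integral_restrict_Int inter ab(3) integral_unique[OF f[OF ab(1)]]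
      using B[OF ab(2)] by (simp add: dist_norm)
  qed auto
qed

section \<open>Beta weights and smooth multipliers\<close>

lemma of_real_powr_divide:
  assumes "p > 0" "q > 0"
  shows "complex_of_real (p / q) powr a = of_real p powr a / of_real q powr a"
  using assms by (simp add: powr_def Ln_of_real ln_div exp_diff ring_distribs del: of_real_divide)

lemma of_real_powr_mult:
  assumes "p > 0" "q > 0"
  shows "complex_of_real (p * q) powr a = of_real p powr a * of_real q powr a"
  using assms by (simp add: powr_def Ln_of_real ln_mult exp_add ring_distribs del: of_real_mult)

lemma of_real_powr_Suc:
  assumes "p > 0"
  shows "complex_of_real p powr (a + 1) = of_real p powr a * of_real p"
  using assms by (simp add: powr_add)

definition beta_weight :: "complex \<Rightarrow> complex \<Rightarrow> real \<Rightarrow> complex" where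
  "beta_weight x y t = of_real t powr (x - 1) * of_real (1 - t) powr (y - 1)"

lemma beta_weight_flip: "beta_weight x y (1 - t) = beta_weight y x t"
  by (simp add: beta_weight_def)

lemma continuous_on_beta_weight: "continuous_on {0<..<1} (beta_weight x y)"
  unfolding beta_weight_def
  by (intro continuous_intros) (auto simp: complex_nonpos_Reals_iff)

text \<open>
  The class of smooth factors that may multiply a Beta weight: powers of \<open>t\<close>, the function
  \<open>e^(zt)\<close>, and the remainders of its Taylor series. The estimates for conditionally convergent
  integrals depend on a factor only through \<open>N\<close>.
\<close>

definition C1_bounded :: "(real \<Rightarrow> complex) \<Rightarrow> (real \<Rightarrow> complex) \<Rightarrow> real \<Rightarrow> bool" where
  "C1_bounded \<phi> \<phi>' N \<longleftrightarrow> (\<forall>t. (\<phi> has_vector_derivative \<phi>' t) (at t)) \<and> continuous_on UNIV \<phi>' \<and>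
     (\<forall>t\<in>{0..1}. norm (\<phi> t) \<le> N \<and> norm (\<phi>' t) \<le> N)"

lemma C1_boundedD:
  assumes "C1_bounded \<phi> \<phi>' N"
  shows "(\<phi> has_vector_derivative \<phi>' t) (at t)" "continuous_on A \<phi>'" "continuous_on A \<phi>"
    "t \<in> {0..1} \<Longrightarrow> norm (\<phi> t) \<le> N" "t \<in> {0..1} \<Longrightarrow> norm (\<phi>' t) \<le> N" "0 \<le> N"
proof -
  show "continuous_on A \<phi>"
    using assms unfolding C1_bounded_def
    by (meson continuous_at_imp_continuous_on has_vector_derivative_continuous)
  have "norm (\<phi> 0) \<le> N" using assms unfolding C1_bounded_def by auto
  then show "0 \<le> N" using norm_ge_zero order_trans by blast
qed (use assms in \<open>auto simp: C1_bounded_def intro: continuous_on_subset\<close>)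

lemma C1_bounded_flip:
  assumes "C1_bounded \<phi> \<phi>' N"
  shows "C1_bounded (\<lambda>t. \<phi> (1 - t)) (\<lambda>t. - \<phi>' (1 - t)) N"
proof -
  have "((\<lambda>t. \<phi> (1 - t)) has_vector_derivative - \<phi>' (1 - t)) (at t)" for t
  proof -
    have "((\<lambda>t::real. 1 - t) has_vector_derivative -1) (at t)"
      by (auto intro!: derivative_eq_intros)
    from vector_diff_chain_at[OF this C1_boundedD(1)[OF assms]] show ?thesis by (simp add: o_def)
  qed
  moreover have "continuous_on UNIV (\<lambda>t. - \<phi>' (1 - t))"
    by (intro continuous_intros continuous_on_compose2[OF C1_boundedD(2)[OF assms, of UNIV]]) auto
  ultimately show ?thesis
    using C1_boundedD(4,5)[OF assms] unfolding C1_bounded_def by auto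
qed

lemma has_integral_flip:
  fixes f :: "real \<Rightarrow> 'a::banach"
  assumes "(f has_integral I) {a..b}"
  shows "((\<lambda>t. f (1 - t)) has_integral I) {1 - b..1 - a}"
proof -
  have "((\<lambda>t. f (- t)) has_integral I) (cbox (-b) (-a))"
    using has_integral_reflect_lemma_real[OF assms] by simp
  from has_integral_affinity'[OF this, of 1 "-1"] show ?thesis
    by (simp add: algebra_simps)
qed

text \<open>
  The remainder of the exponential series is dominated term by term by that of \<open>exp r\<close>.
\<close>

lemma norm_exp_minus_partial_sum_le:
  fixes w :: complex
  assumes "norm w \<le> r"
  shows "norm (exp w - (\<Sum>n<k. w ^ n / fact n)) \<le> exp r - (\<Sum>n<k. r ^ n / fact n)"
proof -
  have sw: "(\<lambda>n. w ^ n / fact n) sums exp w"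
    using exp_converges[of w] by (simp add: scaleR_conv_of_real divide_inverse mult.commute)
  have sr: "(\<lambda>n. r ^ n / fact n) sums exp r"
    using exp_converges[of r] by (simp add: divide_inverse mult.commute)
  have "exp w - (\<Sum>n<k. w ^ n / fact n) = (\<Sum>n. w ^ (n + k) / fact (n + k))"
    using suminf_minus_initial_segment[of "\<lambda>n. w ^ n / fact n" k] sw by (simp add: sums_iff)
  also have "norm \<dots> \<le> (\<Sum>n. r ^ (n + k) / fact (n + k))"
  proof (rule norm_suminf_le)
    show "norm (w ^ (n + k) / fact (n + k)) \<le> r ^ (n + k) / fact (n + k)" for n
      using assms by (auto simp: norm_divide norm_power intro!: divide_right_mono power_mono)
    show "summable (\<lambda>n. r ^ (n + k) / fact (n + k))"
      using sr by (intro summable_ignore_initial_segment) (simp add: sums_iff)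
  qed
  also have "\<dots> = exp r - (\<Sum>n<k. r ^ n / fact n)"
    using suminf_minus_initial_segment[of "\<lambda>n. r ^ n / fact n" k] sr by (simp add: sums_iff)
  finally show ?thesis .
qed

lemma C1_bounded_power: "C1_bounded (\<lambda>t. of_real t ^ n) (\<lambda>t. of_nat n * of_real t ^ (n - 1)) (real n + 1)"
  unfolding C1_bounded_def
proof (intro conjI allI ballI)
  show "((\<lambda>t. complex_of_real t ^ n) has_vector_derivative of_nat n * of_real t ^ (n - 1)) (at t)" for t
    by (rule has_vector_derivative_real_field[where f = "\<lambda>w. w ^ n"]) (auto intro!: derivative_eq_intros)
  show "continuous_on UNIV (\<lambda>t. of_nat n * complex_of_real t ^ (n - 1))"
    by (intro continuous_intros)
  fix t :: real assume t: "t \<in> {0..1}"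
  then have "t ^ n \<le> 1" "t ^ (n - 1) \<le> 1" by (auto intro: power_le_one)
  then show "norm (complex_of_real t ^ n) \<le> real n + 1" "norm (of_nat n * complex_of_real t ^ (n - 1)) \<le> real n + 1"
    using t mult_left_mono[of "t ^ (n - 1)" 1 "real n"] by (auto simp: norm_power norm_mult)
qed

definition exp_tail :: "real \<Rightarrow> nat \<Rightarrow> real" where
  "exp_tail r k = exp r - (\<Sum>n<k. r ^ n / fact n)"

lemma exp_tail_tendsto: "exp_tail r \<longlonglongrightarrow> 0"
proof -
  have "(\<lambda>n. r ^ n / fact n) sums exp r"
    using exp_converges[of r] by (simp add: divide_inverse mult.commute)
  then have "(\<lambda>k. exp r - (\<Sum>n<k. r ^ n / fact n)) \<longlonglongrightarrow> exp r - exp r"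
    unfolding sums_def by (intro tendsto_intros)
  then show ?thesis by (simp add: exp_tail_def[abs_def])
qed

text \<open>
  Differentiating the remainder of order \<open>k + 1\<close> gives \<open>z\<close> times the remainder of order \<open>k\<close>, so
  the Taylor polynomials of \<open>e^(zt)\<close> converge in \<open>C^1\<close>.
\<close>

lemma C1_bounded_exp_minus_partial_sum:
  fixes z :: complex
  shows "C1_bounded (\<lambda>t. exp (z * of_real t) - (\<Sum>n<Suc k. (z * of_real t) ^ n / fact n))
     (\<lambda>t. z * (exp (z * of_real t) - (\<Sum>n<k. (z * of_real t) ^ n / fact n)))
     ((norm z + 1) * exp_tail (norm z) k)"
  unfolding C1_bounded_def
proof (intro conjI allI ballI)
  fix t :: real
  have "((\<lambda>w. exp (z * w) - (\<Sum>n<Suc k. (z * w) ^ n / fact n)) has_field_derivative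
      z * exp (z * w) - (\<Sum>n<Suc k. of_nat n * (z * w) ^ (n - 1) * z / fact n)) (at w)" for w
    by (auto intro!: derivative_eq_intros DERIV_sum simp: mult_ac)
  moreover have "(\<Sum>n<Suc k. of_nat n * (z * w) ^ (n - 1) * z / fact n) = z * (\<Sum>n<k. (z * w) ^ n / fact n)" for w
  proof -
    have "of_nat (Suc n) * (z * w) ^ n * z / fact (Suc n) = z * ((z * w) ^ n / fact n)" for n
      by (simp add: fact_Suc del: of_nat_Suc)
    then show ?thesis
      unfolding sum.lessThan_Suc_shift sum_distrib_left by simp
  qed
  ultimately have "((\<lambda>w. exp (z * w) - (\<Sum>n<Suc k. (z * w) ^ n / fact n)) has_field_derivative
      z * (exp (z * w) - (\<Sum>n<k. (z * w) ^ n / fact n))) (at w)" for w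
    by (simp add: right_diff_distrib)
  from has_vector_derivative_real_field[OF this]
  show "((\<lambda>t. exp (z * of_real t) - (\<Sum>n<Suc k. (z * of_real t) ^ n / fact n)) has_vector_derivative
     z * (exp (z * of_real t) - (\<Sum>n<k. (z * of_real t) ^ n / fact n))) (at t)" .
next
  show "continuous_on UNIV (\<lambda>t. z * (exp (z * of_real t) - (\<Sum>n<k. (z * of_real t) ^ n / fact n)))"
    by (intro continuous_intros) auto
next
  fix t :: real assume "t \<in> {0..1}"
  then have nz: "norm (z * of_real t) \<le> norm z"
    by (auto simp: norm_mult intro!: mult_left_le)
  have le: "norm (exp (z * of_real t) - (\<Sum>n<k. (z * of_real t) ^ n / fact n)) \<le> exp_tail (norm z) k" for k
    unfolding exp_tail_def by (rule norm_exp_minus_partial_sum_le[OF nz])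
  have pos: "exp_tail (norm z) k \<ge> 0" using le[of k] norm_ge_zero order_trans by blast
  have "exp_tail (norm z) (Suc k) \<le> exp_tail (norm z) k" by (simp add: exp_tail_def)
  also have "\<dots> \<le> (norm z + 1) * exp_tail (norm z) k"
    using pos by (simp add: algebra_simps)
  finally show "norm (exp (z * of_real t) - (\<Sum>n<Suc k. (z * of_real t) ^ n / fact n)) \<le> (norm z + 1) * exp_tail (norm z) k"
    using le[of "Suc k"] by simp
  have "norm z * norm (exp (z * of_real t) - (\<Sum>n<k. (z * of_real t) ^ n / fact n)) \<le> (norm z + 1) * exp_tail (norm z) k"
    using le[of k] by (intro mult_mono) auto
  then show "norm (z * (exp (z * of_real t) - (\<Sum>n<k. (z * of_real t) ^ n / fact n))) \<le> (norm z + 1) * exp_tail (norm z) k"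
    by (simp add: norm_mult)
qed

lemma C1_bounded_exp: "\<exists>N. C1_bounded (\<lambda>t. exp (z * of_real t)) (\<lambda>t. z * exp (z * of_real t)) N"
proof -
  have "((\<lambda>t. exp (z * of_real t)) has_vector_derivative z * exp (z * of_real t)) (at t)" for t
    by (rule has_vector_derivative_real_field) (auto intro!: derivative_eq_intros)
  moreover have "norm (exp (z * of_real t)) \<le> exp (norm z)" if "t \<in> {0..1}" for t
  proof -
    have "norm (exp (z * of_real t)) \<le> exp (norm (z * of_real t))" by (rule norm_exp)
    also have "norm (z * of_real t) \<le> norm z" using that by (auto simp: norm_mult intro!: mult_left_le)
    finally show ?thesis by simp
  qed
  ultimately have "C1_bounded (\<lambda>t. exp (z * of_real t)) (\<lambda>t. z * exp (z * of_real t)) ((norm z + 1) * exp (norm z))"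
    unfolding C1_bounded_def
    by (auto simp: norm_mult intro!: continuous_intros mult_mono order_trans[OF _ mult_mono[of 1 "norm z + 1" "exp (norm z)" "exp (norm z)"]])
  then show ?thesis ..
qed

text \<open>
  The endpoint \<open>t = 0\<close> is included because \<open>0 powr a = 0\<close> for every \<open>a\<close>.
\<close>

lemma beta_weight_power:
  assumes "t \<in> {0..1}"
  shows "beta_weight (x + of_nat n) y t = beta_weight x y t * of_real t ^ n"
proof (cases "t = 0")
  case False
  then have "complex_of_real t powr (x + of_nat n - 1) = of_real t powr (x - 1) * of_real t ^ n"
    using powr_add[of "complex_of_real t" "x - 1" "of_nat n"] by (simp add: powr_nat' algebra_simps)
  then show ?thesis by (simp add: beta_weight_def mult_ac)
qed (simp add: beta_weight_def)

text \<open>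
  Here the convergence is absolute: the partial sums of \<open>e^(zt)\<close> are bounded by \<open>e^|z|\<close>, and each
  term is a Beta integral.
\<close>

lemma beta_weight_exp_integral:
  assumes x: "Re x > 0" and y: "Re y > 0"
  shows "integral {0<..<1} (\<lambda>t. beta_weight x y t * exp (z * of_real t)) = Beta x y * confluent x (x + y) z"
proof -
  define g where "g = (\<lambda>t::real. exp (norm z) * (t powr (Re x - 1) * (1 - t) powr (Re y - 1)))"
  have g: "g integrable_on {0<..<1}"
    unfolding g_def using has_integral_Beta_real[OF x y]
    by (intro integrable_on_mult_right) (auto simp: has_integral_Icc_iff_Ioo)
  have monomial: "((\<lambda>t. beta_weight x y t * of_real t ^ n) has_integral Beta x y * (pochhammer x n / pochhammer (x + y) n)) {0<..<1}" for n
  proof -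
    have "((\<lambda>t. beta_weight (x + of_nat n) y t) has_integral Beta (x + of_nat n) y) {0<..<1}"
      unfolding beta_weight_def has_integral_Icc_iff_Ioo[symmetric]
      using x y by (intro has_integral_Beta_complex) auto
    then show ?thesis
      unfolding Beta_add_of_nat[OF x y] by (rule has_integral_eq[rotated]) (auto simp: beta_weight_power)
  qed
  have part: "((\<lambda>t. beta_weight x y t * (\<Sum>n<k. (z * of_real t) ^ n / fact n)) has_integral
     (\<Sum>n<k. Beta x y * (pochhammer x n / pochhammer (x + y) n) * (z ^ n / fact n))) {0<..<1}" for k
  proof -
    have "((\<lambda>t. \<Sum>n<k. beta_weight x y t * of_real t ^ n * (z ^ n / fact n)) has_integral
     (\<Sum>n<k. Beta x y * (pochhammer x n / pochhammer (x + y) n) * (z ^ n / fact n))) {0<..<1}"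
      by (intro has_integral_sum has_integral_mult_left monomial) auto
    then show ?thesis
      by (rule has_integral_eq[rotated]) (auto simp: sum_distrib_left power_mult_distrib mult_ac)
  qed
  have "(\<lambda>k. integral {0<..<1} (\<lambda>t. beta_weight x y t * (\<Sum>n<k. (z * of_real t) ^ n / fact n))) \<longlonglongrightarrow>
     integral {0<..<1} (\<lambda>t. beta_weight x y t * exp (z * of_real t))"
  proof (rule dominated_convergence(2)[OF _ g])
    show "(\<lambda>t. beta_weight x y t * (\<Sum>n<k. (z * of_real t) ^ n / fact n)) integrable_on {0<..<1}" for k
      using part by blast
    fix k and t :: real assume t: "t \<in> {0<..<1}"
    have "norm (\<Sum>n<k. (z * of_real t) ^ n / fact n) \<le> (\<Sum>n<k. norm z ^ n / fact n)"
    proof (rule sum_norm_le)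
      fix n
      have "norm (z * of_real t) \<le> norm z" using t by (auto simp: norm_mult intro!: mult_left_le)
      then show "norm ((z * of_real t) ^ n / fact n) \<le> norm z ^ n / fact n"
        by (simp only: norm_divide norm_power norm_fact) (intro divide_right_mono power_mono, auto)
    qed
    also have "\<dots> \<le> exp (norm z)"
      using order_trans[OF norm_ge_zero norm_exp_minus_partial_sum_le[of 0 "norm z" k]] by simp
    finally have "norm (\<Sum>n<k. (z * of_real t) ^ n / fact n) \<le> exp (norm z)" .
    then show "norm (beta_weight x y t * (\<Sum>n<k. (z * of_real t) ^ n / fact n)) \<le> g t"
      using t mult_right_mono[of _ "exp (norm z)" "t powr (Re x - 1) * (1 - t) powr (Re y - 1)"]
      by (simp add: g_def beta_weight_def norm_mult norm_powr_real_powr mult_ac del: of_real_diff)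
  next
    fix t :: real
    have "(\<lambda>n. (z * of_real t) ^ n / fact n) sums exp (z * of_real t)"
      using exp_converges[of "z * of_real t"] by (simp add: scaleR_conv_of_real divide_inverse mult.commute)
    then show "(\<lambda>k. beta_weight x y t * (\<Sum>n<k. (z * of_real t) ^ n / fact n)) \<longlonglongrightarrow> beta_weight x y t * exp (z * of_real t)"
      unfolding sums_def by (rule tendsto_mult_left)
  qed
  then have "(\<lambda>n. Beta x y * (pochhammer x n / pochhammer (x + y) n * z ^ n / fact n)) sums
      integral {0<..<1} (\<lambda>t. beta_weight x y t * exp (z * of_real t))"
    unfolding sums_def integral_unique[OF part] by (simp add: mult_ac)
  moreover have "Beta x y \<noteq> 0"
    using x y by (simp add: Beta_def Gamma_eq_zero_iff nonpos_Ints_Re_pos)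
  ultimately have "(\<lambda>n. pochhammer x n / pochhammer (x + y) n * z ^ n / fact n) sums
      (integral {0<..<1} (\<lambda>t. beta_weight x y t * exp (z * of_real t)) / Beta x y)"
    using sums_divide[of "\<lambda>n. Beta x y * (pochhammer x n / pochhammer (x + y) n * z ^ n / fact n)" _ "Beta x y"] by simp
  then show ?thesis
    using \<open>Beta x y \<noteq> 0\<close> by (simp add: confluent_def sums_iff)
qed

section \<open>The Mellin transform of a scaled kernel averaged against a Beta weight\<close>

text \<open>
  A kernel on the positive half line whose Mellin integral at \<open>s\<close> converges, possibly only
  conditionally.
\<close>

locale mellin_kernel =
  fixes W :: "real \<Rightarrow> complex" and s :: complex
  assumes continuous_on_W: "continuous_on {0<..} W"
    and integrable_W: "(\<lambda>v. of_real v powr (s - 1) * W v) integrable_on {0..}"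
begin

definition partial_mellin :: "real \<Rightarrow> complex" where
  "partial_mellin R = integral {0..R} (\<lambda>v. of_real v powr (s - 1) * W v)"

lemma partial_mellin_0: "partial_mellin 0 = 0" by (simp add: partial_mellin_def)

lemma partial_mellin_has_vector_derivative:
  assumes "v > 0"
  shows "(partial_mellin has_vector_derivative (of_real v powr (s - 1) * W v)) (at v)"
proof -
  have int: "(\<lambda>v. of_real v powr (s - 1) * W v) integrable_on {0..v+1}"
    using integrable_on_subinterval[OF integrable_W, of 0 "v+1"] by auto
  have "continuous_on {0<..} (\<lambda>v. of_real v powr (s - 1) * W v)"
    by (intro continuous_intros continuous_on_W) (auto simp: complex_nonpos_Reals_iff)
  then have "isCont (\<lambda>v. of_real v powr (s - 1) * W v) v"
    using assms by (simp add: continuous_on_eq_continuous_at)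
  from integral_has_vector_derivative_continuous_at[OF int, of v "{}"] assms
    continuous_at_imp_continuous_within[OF this]
  have "((\<lambda>u. integral {0..u} (\<lambda>v. of_real v powr (s - 1) * W v)) has_vector_derivative
     of_real v powr (s - 1) * W v) (at v within {0..v+1})" by auto
  moreover have "at v within {0..v+1} = at v"
    using assms by (intro at_within_interior) auto
  ultimately show ?thesis unfolding partial_mellin_def[abs_def] by simp
qed

lemma continuous_on_partial_mellin: "continuous_on {0..} partial_mellin"
  unfolding continuous_on_eq_continuous_within
proof
  fix v :: real assume v: "v \<in> {0..}"
  have int: "(\<lambda>v. of_real v powr (s - 1) * W v) integrable_on {0..v+1}"
    using integrable_on_subinterval[OF integrable_W, of 0 "v+1"] by auto
  from indefinite_integral_continuous_1[OF this] have "continuous_on {0..v+1} partial_mellin"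
    unfolding partial_mellin_def[abs_def] .
  then have "continuous (at v within {0..v+1}) partial_mellin"
    using v by (auto simp: continuous_on_eq_continuous_within)
  moreover have "at v within {0..v+1} = at v within {0..}"
    by (rule at_within_nhd[of _ "{..<v+1}"]) auto
  ultimately show "continuous (at v within {0..}) partial_mellin" by (simp add: continuous_within)
qed

lemma partial_mellin_tendsto:
  "(partial_mellin \<longlongrightarrow> integral {0..} (\<lambda>v. of_real v powr (s - 1) * W v)) at_top"
  unfolding partial_mellin_def[abs_def] by (rule improper_integral_tendsto[OF integrable_W])

lemma partial_mellin_bounded: obtains K where "K \<ge> 0" "\<And>v. v \<ge> 0 \<Longrightarrow> norm (partial_mellin v) \<le> K"
proof -
  have "\<forall>\<^sub>F v in at_top. dist (partial_mellin v) (integral {0..} (\<lambda>v. of_real v powr (s - 1) * W v)) < 1"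
    using partial_mellin_tendsto by (rule tendstoD) simp
  then obtain R where R: "\<And>v. v \<ge> R \<Longrightarrow> norm (partial_mellin v) \<le> norm (integral {0..} (\<lambda>v. of_real v powr (s - 1) * W v)) + 1"
    unfolding eventually_at_top_linorder dist_norm
    by (smt (verit) norm_triangle_sub)
  have "bounded (partial_mellin ` {0..R})"
    by (intro compact_imp_bounded compact_continuous_image continuous_on_subset[OF continuous_on_partial_mellin]) auto
  then obtain L where L: "\<And>v. v \<in> {0..R} \<Longrightarrow> norm (partial_mellin v) \<le> L"
    unfolding bounded_iff by blast
  show ?thesis
  proof (rule that[of "max (max 0 L) (norm (integral {0..} (\<lambda>v. of_real v powr (s - 1) * W v)) + 1)"])
    fix v :: real assume "v \<ge> 0"
    then show "norm (partial_mellin v) \<le> max (max 0 L) (norm (integral {0..} (\<lambda>v. of_real v powr (s - 1) * W v)) + 1)"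
      using R[of v] L[of v] by (cases "v \<le> R") auto
  qed auto
qed

text \<open>
  If \<open>W v\<close> is the Wright function at \<open>-v\<close> and \<open>\<phi> t = t^n\<close>, this is the integrand of the
  \<open>\<Psi>\<close>-beta function with parameters \<open>x + n\<close> and \<open>y\<close>.
\<close>

definition beta_kernel :: "complex \<Rightarrow> complex \<Rightarrow> (real \<Rightarrow> complex) \<Rightarrow> real \<Rightarrow> real \<Rightarrow> complex" where
  "beta_kernel x y \<phi> p t = beta_weight x y t * \<phi> t * W (p / (t * (1 - t)))"

lemma beta_kernel_flip: "beta_kernel x y \<phi> p (1 - t) = beta_kernel y x (\<lambda>t. \<phi> (1 - t)) p t"
  by (simp add: beta_kernel_def beta_weight_flip mult.commute)

text \<open>
  Put \<open>U t = partial_mellin (p/(t(1-t)))\<close>, a bounded function. Since \<open>U'\<close> contains the factor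
  \<open>W(p/(t(1-t)))\<close>, the kernel times \<open>p^s\<close> equals \<open>- t^(x+s) \<Phi>(t) U'(t)\<close> with
  \<open>\<Phi>(t) = (1-t)^(y+s) \<phi>(t) / (1-2t)\<close>, and integration by parts applies. The denominator comes
  from the derivative of \<open>t(1-t)\<close> and is the reason for staying on \<open>[0,1/4]\<close>, away from its zero
  at \<open>1/2\<close>. The constant is independent of \<open>p\<close>, \<open>\<delta>\<close> and \<open>\<phi>\<close>.
\<close>

lemma left_tail_bound:
  assumes x: "Re (x + s) > 0"
  shows "\<exists>C\<ge>0. \<forall>\<phi> \<phi>' N \<delta> p. C1_bounded \<phi> \<phi>' N \<longrightarrow> 0 < \<delta> \<longrightarrow> \<delta> \<le> 1/4 \<longrightarrow> p > 0 \<longrightarrow>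
     beta_kernel x y \<phi> p integrable_on {0..\<delta>} \<and>
     norm (of_real p powr s * integral {0..\<delta>} (beta_kernel x y \<phi> p)) \<le> C * N * \<delta> powr Re (x + s)"
proof -
  obtain K where K: "K \<ge> 0" "\<And>v. v \<ge> 0 \<Longrightarrow> norm (partial_mellin v) \<le> K" using partial_mellin_bounded by blast
  define \<kappa> where "\<kappa> = (\<lambda>t::real. complex_of_real (1 - t) powr (y + s) * of_real (inverse (1 - 2 * t)))"
  define \<kappa>' where "\<kappa>' = (\<lambda>t::real. complex_of_real (1 - t) powr (y + s) * of_real (2 * inverse (1 - 2 * t) ^ 2)
     + (-1) *\<^sub>R ((y + s) * complex_of_real (1 - t) powr (y + s - 1)) * of_real (inverse (1 - 2 * t)))"
  have \<kappa>: "(\<kappa> has_vector_derivative \<kappa>' t) (at t)" if "t \<in> {0..1/4}" for t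
  proof -
    have "((\<lambda>t::real. 1 - t) has_vector_derivative -1) (at t)"
      by (auto intro!: derivative_eq_intros)
    from vector_diff_chain_at[OF this has_vector_derivative_of_real_powr[of "1 - t" "y + s"]] that
    have 1: "((\<lambda>t. complex_of_real (1 - t) powr (y + s)) has_vector_derivative
      (-1) *\<^sub>R ((y + s) * complex_of_real (1 - t) powr (y + s - 1))) (at t)" by (simp add: o_def)
    have "((\<lambda>t::real. inverse (1 - 2 * t)) has_real_derivative (2 * inverse (1 - 2 * t) ^ 2)) (at t)"
      using that by (auto intro!: derivative_eq_intros simp: power2_eq_square)
    then have 2: "((\<lambda>t::real. complex_of_real (inverse (1 - 2 * t))) has_vector_derivative
        of_real (2 * inverse (1 - 2 * t) ^ 2)) (at t)"
      by (intro has_vector_derivative_of_real) (simp add: has_real_derivative_iff_has_vector_derivative)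
    show ?thesis unfolding \<kappa>_def \<kappa>'_def by (rule has_vector_derivative_mult[OF 1 2])
  qed
  have contK: "continuous_on {0..1/4} \<kappa>" 
    using \<kappa> by (meson continuous_at_imp_continuous_on has_vector_derivative_continuous)
  have contK': "continuous_on {0..1/4} \<kappa>'"
    unfolding \<kappa>'_def by (intro continuous_intros) (auto simp: complex_nonpos_Reals_iff)
  obtain A1 where A1: "\<And>t. t \<in> {0..1/4} \<Longrightarrow> norm (\<kappa> t) \<le> A1"
    using compact_imp_bounded[OF compact_continuous_image[OF contK compact_Icc]] by (auto simp: bounded_iff simp del: atLeastAtMost_iff)
  obtain A2 where A2: "\<And>t. t \<in> {0..1/4} \<Longrightarrow> norm (\<kappa>' t) \<le> A2"
    using compact_imp_bounded[OF compact_continuous_image[OF contK' compact_Icc]] by (auto simp: bounded_iff simp del: atLeastAtMost_iff)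
  define A where "A = max 0 (max A1 A2)"
  have A: "0 \<le> A" "\<And>t. t \<in> {0..1/4} \<Longrightarrow> norm (\<kappa> t) \<le> A" "\<And>t. t \<in> {0..1/4} \<Longrightarrow> norm (\<kappa>' t) \<le> A"
    using A1 A2 by (fastforce simp: A_def)+
  define \<xi> where "\<xi> = x + s"
  define C where "C = K * (2 * A) * ((norm \<xi> + 1) / Re \<xi> + 1)"
  show ?thesis
  proof (intro exI[of _ C] conjI allI impI)
    show "C \<ge> 0" using K(1) A(1) x by (auto simp: C_def \<xi>_def)
    fix \<phi> \<phi>' N and \<delta> p :: real
    assume \<phi>: "C1_bounded \<phi> \<phi>' N" and \<delta>: "0 < \<delta>" "\<delta> \<le> 1/4" and p: "p > 0"
    note N0 = C1_boundedD(6)[OF \<phi>]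
    define \<Phi> where "\<Phi> = (\<lambda>t. \<kappa> t * \<phi> t)"
    define \<Phi>' where "\<Phi>' = (\<lambda>t. \<kappa> t * \<phi>' t + \<kappa>' t * \<phi> t)"
    define U where "U = (\<lambda>t. partial_mellin (p / (t * (1 - t))))"
    define U' where "U' = (\<lambda>t. (- p * (1 - 2 * t) / (t * (1 - t))^2) *\<^sub>R
       (of_real (p / (t * (1 - t))) powr (s - 1) * W (p / (t * (1 - t)))))"
    have \<Phi>: "(\<Phi> has_vector_derivative \<Phi>' t) (at t)" if "t \<in> {0..\<delta>}" for t
      unfolding \<Phi>_def \<Phi>'_def using that \<delta>
      by (intro has_vector_derivative_mult \<kappa> C1_boundedD(1)[OF \<phi>]) auto
    have \<Phi>'_cont: "continuous_on {0..\<delta>} \<Phi>'"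
      unfolding \<Phi>'_def using \<delta>
      by (intro continuous_intros C1_boundedD(2,3)[OF \<phi>] continuous_on_subset[OF contK] continuous_on_subset[OF contK']) auto
    have N: "norm (\<Phi> t) \<le> 2 * A * N \<and> norm (\<Phi>' t) \<le> 2 * A * N" if "t \<in> {0..\<delta>}" for t
    proof -
      have t: "t \<in> {0..1/4}" "t \<in> {0..1}" using that \<delta> by auto
      have 1: "norm (\<kappa> t) * norm (\<phi> t) \<le> A * N" "norm (\<kappa> t) * norm (\<phi>' t) \<le> A * N" "norm (\<kappa>' t) * norm (\<phi> t) \<le> A * N"
        using A t C1_boundedD(4,5)[OF \<phi> t(2)] by (auto intro!: mult_mono)
      have "norm (\<Phi>' t) \<le> norm (\<kappa> t) * norm (\<phi>' t) + norm (\<kappa>' t) * norm (\<phi> t)"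
        unfolding \<Phi>'_def by (metis norm_mult norm_triangle_ineq)
      moreover have "A * N \<ge> 0" using A N0 by auto
      ultimately show ?thesis using 1 by (auto simp: \<Phi>_def norm_mult)
    qed
    have U: "(U has_vector_derivative U' t) (at t)" if "t \<in> {0<..\<delta>}" for t
    proof -
      have "((\<lambda>t. p / (t * (1 - t))) has_real_derivative (- p * (1 - 2 * t) / (t * (1 - t))^2)) (at t)"
        using that \<delta> by (auto intro!: derivative_eq_intros simp: power2_eq_square field_simps)
      then have 1: "((\<lambda>t. p / (t * (1 - t))) has_vector_derivative (- p * (1 - 2 * t) / (t * (1 - t))^2)) (at t)"
        by (simp add: has_real_derivative_iff_has_vector_derivative)
      have "p / (t * (1 - t)) > 0" using that \<delta> p by auto
      from vector_diff_chain_at[OF 1 partial_mellin_has_vector_derivative[OF this]]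
      show ?thesis unfolding U_def U'_def by (simp add: o_def)
    qed
    have KU: "norm (U t) \<le> K" if "t \<in> {0<..\<delta>}" for t
      unfolding U_def using that \<delta> p by (intro K) auto
    have \<delta>1: "\<delta> \<le> 1" using \<delta> by simp
    have x': "Re \<xi> > 0" using x by (simp add: \<xi>_def)
    note parts = integration_by_parts_bound[OF x' \<delta>(1) \<delta>1 \<Phi> \<Phi>'_cont N U KU]
    have eq: "beta_kernel x y \<phi> p t = - (of_real p powr (- s)) * (of_real t powr \<xi> * \<Phi> t * U' t)" if "t \<in> {0..\<delta>}" for t
    proof (cases "t = 0")
      case True then show ?thesis by (simp add: beta_kernel_def beta_weight_def)
    next
      case False
      then have t: "0 < t" "t < 1" "1 - 2 * t > 0" "0 < t * (1 - t)" using that \<delta> by auto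
      have 1: "complex_of_real t powr \<xi> = of_real t powr (x - 1) * of_real t powr (s - 1) * of_real t ^ 2"
      proof -
        have "\<xi> = x - 1 + (s - 1) + 1 + 1" by (simp add: \<xi>_def)
        then show ?thesis
          by (simp only: of_real_powr_Suc[OF t(1)] powr_add powr_to_1 power2_eq_square mult.assoc)
      qed
      have 2: "complex_of_real (1 - t) powr (y + s) = of_real (1 - t) powr (y - 1) * of_real (1 - t) powr (s - 1) * of_real (1 - t) ^ 2"
      proof -
        have "0 < 1 - t" "y + s = y - 1 + (s - 1) + 1 + 1" using t by auto
        then show ?thesis
          by (simp only: of_real_powr_Suc powr_add powr_to_1 power2_eq_square mult.assoc)
      qed
      have 3: "of_real (p / (t * (1 - t))) powr (s - 1) =
          complex_of_real p powr (s - 1) / (of_real t powr (s - 1) * of_real (1 - t) powr (s - 1))"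
        using of_real_powr_divide[OF p t(4)] of_real_powr_mult[OF t(1), of "1 - t"] t by simp
      have 4: "complex_of_real p powr (- s) * of_real p powr (s - 1) * of_real p = 1"
        using p of_real_powr_Suc[OF p, of "s - 1"] by (simp add: powr_minus field_simps)
      have nz: "complex_of_real t \<noteq> 0" "complex_of_real (1 - t) \<noteq> 0" "complex_of_real (1 - 2 * t) \<noteq> 0"
         "of_real t powr (s - 1) \<noteq> (0::complex)" "of_real (1 - t) powr (s - 1) \<noteq> (0::complex)"
        using t by (simp_all del: of_real_diff of_real_mult)
      have "- (of_real p powr (- s)) * (of_real t powr \<xi> * \<Phi> t * U' t)
         = (complex_of_real p powr (- s) * of_real p powr (s - 1) * of_real p) *
           (of_real t powr (x - 1) * of_real (1 - t) powr (y - 1) * \<phi> t * W (p / (t * (1 - t))))"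
        unfolding 1 2 3 \<Phi>_def \<kappa>_def U'_def
        unfolding scaleR_conv_of_real of_real_divide of_real_mult of_real_minus
          of_real_power of_real_inverse using nz
        by (simp add: field_simps power2_eq_square del: of_real_diff)
      then show ?thesis unfolding 4 by (simp add: beta_kernel_def beta_weight_def)
    qed
    have hi: "(beta_kernel x y \<phi> p has_integral - (of_real p powr (- s)) * integral {0..\<delta>} (\<lambda>t. of_real t powr \<xi> * \<Phi> t * U' t)) {0..\<delta>}"
      by (rule has_integral_eq[OF _ has_integral_mult_right[OF integrable_integral[OF parts(1)]]]) (use eq in auto)
    then show "beta_kernel x y \<phi> p integrable_on {0..\<delta>}" by blast
    have "of_real p powr s * integral {0..\<delta>} (beta_kernel x y \<phi> p) = - integral {0..\<delta>} (\<lambda>t. of_real t powr \<xi> * \<Phi> t * U' t)"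
      unfolding integral_unique[OF hi] using p by (simp add: powr_minus)
    then show "norm (of_real p powr s * integral {0..\<delta>} (beta_kernel x y \<phi> p)) \<le> C * N * \<delta> powr Re (x + s)"
      using parts(2) by (simp add: C_def \<xi>_def mult_ac)
  qed
qed

lemma continuous_on_beta_kernel:
  assumes "C1_bounded \<phi> \<phi>' N" "p > 0"
  shows "continuous_on {0<..<1} (beta_kernel x y \<phi> p)"
  unfolding beta_kernel_def[abs_def]
  by (intro continuous_intros continuous_on_beta_weight C1_boundedD(3)[OF assms(1)]
      continuous_on_compose2[OF continuous_on_W]) (use assms(2) in auto)

text \<open>
  The tail at \<open>1\<close> is the reflection under \<open>t \<mapsto> 1-t\<close> of a tail at \<open>0\<close> with \<open>x\<close> and \<open>y\<close>
  interchanged.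
\<close>

lemma tail_bound:
  assumes x: "Re (x + s) > 0" and y: "Re (y + s) > 0"
  shows "\<exists>C\<ge>0. \<forall>\<phi> \<phi>' N \<delta> p. C1_bounded \<phi> \<phi>' N \<longrightarrow> 0 < \<delta> \<longrightarrow> \<delta> \<le> 1/4 \<longrightarrow> p > 0 \<longrightarrow>
     beta_kernel x y \<phi> p integrable_on {0..1} \<and>
     norm (of_real p powr s * (integral {0..1} (beta_kernel x y \<phi> p) - integral {\<delta>..1-\<delta>} (beta_kernel x y \<phi> p)))
       \<le> C * N * (\<delta> powr Re (x + s) + \<delta> powr Re (y + s))"
proof -
  obtain C1 where C1: "C1 \<ge> 0" "\<And>\<phi> \<phi>' N \<delta> p. C1_bounded \<phi> \<phi>' N \<Longrightarrow> 0 < \<delta> \<Longrightarrow> \<delta> \<le> 1/4 \<Longrightarrow> p > 0 \<Longrightarrow>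
     beta_kernel x y \<phi> p integrable_on {0..\<delta>} \<and>
     norm (of_real p powr s * integral {0..\<delta>} (beta_kernel x y \<phi> p)) \<le> C1 * N * \<delta> powr Re (x + s)"
    using left_tail_bound[OF x, of y] by blast
  obtain C2 where C2: "C2 \<ge> 0" "\<And>\<phi> \<phi>' N \<delta> p. C1_bounded \<phi> \<phi>' N \<Longrightarrow> 0 < \<delta> \<Longrightarrow> \<delta> \<le> 1/4 \<Longrightarrow> p > 0 \<Longrightarrow>
     beta_kernel y x \<phi> p integrable_on {0..\<delta>} \<and>
     norm (of_real p powr s * integral {0..\<delta>} (beta_kernel y x \<phi> p)) \<le> C2 * N * \<delta> powr Re (y + s)"
    using left_tail_bound[OF y, of x] by blast
  define C where "C = max C1 C2"
  show ?thesis
  proof (intro exI[of _ C] conjI allI impI)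
    show "C \<ge> 0" using C1(1) by (simp add: C_def)
    fix \<phi> \<phi>' N and \<delta> p :: real
    assume \<phi>: "C1_bounded \<phi> \<phi>' N" and \<delta>: "0 < \<delta>" "\<delta> \<le> 1/4" and p: "p > 0"
    define k where "k = beta_kernel x y \<phi> p"
    note l = C1(2)[OF \<phi> \<delta> p]
    note r = C2(2)[OF C1_bounded_flip[OF \<phi>] \<delta> p]
    have L: "(k has_integral integral {0..\<delta>} k) {0..\<delta>}"
      using l by (auto simp: k_def)
    have "((\<lambda>t. beta_kernel y x (\<lambda>t. \<phi> (1 - t)) p (1 - t)) has_integral
        integral {0..\<delta>} (beta_kernel y x (\<lambda>t. \<phi> (1 - t)) p)) {1-\<delta>..1-0}"
      by (intro has_integral_flip integrable_integral) (use r in auto)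
    then have R: "(k has_integral integral {0..\<delta>} (beta_kernel y x (\<lambda>t. \<phi> (1 - t)) p)) {1-\<delta>..1}"
      unfolding beta_kernel_flip by (simp add: k_def)
    have "k integrable_on {\<delta>..1-\<delta>}"
      unfolding k_def using \<delta>
      by (intro integrable_continuous_real continuous_on_subset[OF continuous_on_beta_kernel[OF \<phi> p]]) auto
    then have M: "(k has_integral integral {\<delta>..1-\<delta>} k) {\<delta>..1-\<delta>}" by auto
    have LM: "(k has_integral (integral {0..\<delta>} k + integral {\<delta>..1-\<delta>} k)) {0..1-\<delta>}"
      using has_integral_combine[OF _ _ L M] \<delta> by auto
    have T: "(k has_integral (integral {0..\<delta>} k + integral {\<delta>..1-\<delta>} k + integral {0..\<delta>} (beta_kernel y x (\<lambda>t. \<phi> (1 - t)) p))) {0..1}"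
      using has_integral_combine[OF _ _ LM R] \<delta> by auto
    then show "beta_kernel x y \<phi> p integrable_on {0..1}" by (auto simp: k_def)
    have "norm (of_real p powr s * (integral {0..1} k - integral {\<delta>..1-\<delta>} k)) =
      norm (of_real p powr s * integral {0..\<delta>} k + of_real p powr s * integral {0..\<delta>} (beta_kernel y x (\<lambda>t. \<phi> (1 - t)) p))"
      unfolding integral_unique[OF T] by (simp add: algebra_simps)
    also have "\<dots> \<le> C1 * N * \<delta> powr Re (x + s) + C2 * N * \<delta> powr Re (y + s)"
      using l r by (intro norm_triangle_mono) (auto simp: k_def)
    also have "\<dots> \<le> C * N * \<delta> powr Re (x + s) + C * N * \<delta> powr Re (y + s)"
      using C1_boundedD(6)[OF \<phi>] by (intro add_mono mult_right_mono) (auto simp: C_def)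
    finally show "norm (of_real p powr s * (integral {0..1} (beta_kernel x y \<phi> p) - integral {\<delta>..1-\<delta>} (beta_kernel x y \<phi> p)))
       \<le> C * N * (\<delta> powr Re (x + s) + \<delta> powr Re (y + s))"
      by (simp add: k_def algebra_simps)
  qed
qed

lemma beta_kernel_integrable:
  assumes "Re (x + s) > 0" "Re (y + s) > 0" "C1_bounded \<phi> \<phi>' N" "p > 0"
  shows "beta_kernel x y \<phi> p integrable_on {0..1}"
  using tail_bound[OF assms(1,2)] assms(3,4) by (metis (no_types, opaque_lifting) order_refl zero_less_divide_1_iff zero_less_numeral)

text \<open>
  The tails are controlled by \<open>tail_bound\<close> with \<open>\<delta> = 1/4\<close>, and on \<open>[1/4,3/4]\<close> the kernel is
  continuous. Linearity of the bound in \<open>N\<close> allows limits in \<open>C^1\<close> to be taken under the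
  integral.
\<close>

lemma beta_kernel_integral_bound:
  assumes x: "Re (x + s) > 0" and y: "Re (y + s) > 0" and p: "p > 0"
  shows "\<exists>C. \<forall>\<phi> \<phi>' N. C1_bounded \<phi> \<phi>' N \<longrightarrow> norm (integral {0..1} (beta_kernel x y \<phi> p)) \<le> C * N"
proof -
  obtain C where C: "C \<ge> 0" "\<And>\<phi> \<phi>' N \<delta> p. C1_bounded \<phi> \<phi>' N \<Longrightarrow> 0 < \<delta> \<Longrightarrow> \<delta> \<le> 1/4 \<Longrightarrow> p > 0 \<Longrightarrow>
     norm (of_real p powr s * (integral {0..1} (beta_kernel x y \<phi> p) - integral {\<delta>..1-\<delta>} (beta_kernel x y \<phi> p)))
       \<le> C * N * (\<delta> powr Re (x + s) + \<delta> powr Re (y + s))"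
    using tail_bound[OF x y] by blast
  define D where "D = (1/4) powr Re (x + s) + (1/4) powr Re (y + s)"
  have one: "C1_bounded (\<lambda>_. 1) (\<lambda>_. 0) 1"
    by (auto simp: C1_bounded_def)
  have "continuous_on {1/4..3/4} (beta_kernel x y (\<lambda>_. 1) p)"
    by (rule continuous_on_subset[OF continuous_on_beta_kernel[OF one p]]) auto
  from compact_imp_bounded[OF compact_continuous_image[OF this compact_Icc]]
  obtain B where B: "B > 0" "\<And>t. t \<in> {1/4..3/4} \<Longrightarrow> norm (beta_kernel x y (\<lambda>_. 1) p t) \<le> B"
    unfolding bounded_pos by auto
  show ?thesis
  proof (intro exI[of _ "C * D / p powr Re s + B"] allI impI)
    fix \<phi> \<phi>' N assume \<phi>: "C1_bounded \<phi> \<phi>' N"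
    note N = C1_boundedD(4,6)[OF \<phi>]
    define I where "I = integral {1/4..3/4} (beta_kernel x y \<phi> p)"
    have "norm I \<le> B * N * (3/4 - 1/4)"
      unfolding I_def
    proof (rule integral_bound)
      show "continuous_on {1/4..3/4} (beta_kernel x y \<phi> p)"
        by (rule continuous_on_subset[OF continuous_on_beta_kernel[OF \<phi> p]]) auto
      fix t :: real assume t: "t \<in> {1/4..3/4}"
      have "beta_kernel x y \<phi> p t = beta_kernel x y (\<lambda>_. 1) p t * \<phi> t" by (simp add: beta_kernel_def)
      then show "norm (beta_kernel x y \<phi> p t) \<le> B * N"
        using B N(1)[of t] B(2)[of t] t by (auto simp: norm_mult intro!: mult_mono)
    qed simp
    moreover have "0 \<le> B * N" using B N by simp
    ultimately have I: "norm I \<le> B * N" by simp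
    have "p powr Re s * norm (integral {0..1} (beta_kernel x y \<phi> p) - I) \<le> C * N * D"
      using C(2)[OF \<phi>, of "1/4" p] p by (simp add: I_def D_def norm_mult norm_powr_real_powr)
    then have "norm (integral {0..1} (beta_kernel x y \<phi> p) - I) \<le> C * D / p powr Re s * N"
      using p by (simp add: field_simps)
    then show "norm (integral {0..1} (beta_kernel x y \<phi> p)) \<le> (C * D / p powr Re s + B) * N"
      using I norm_triangle_sub[of "integral {0..1} (beta_kernel x y \<phi> p)" I] by (simp add: algebra_simps)
  qed
qed

text \<open>
  Away from the endpoints the integrand is jointly continuous, so the integrals may be swapped; the
  inner one is explicit because \<open>p^(s-1) W(p/q)\<close> is the derivative in \<open>p\<close> of
  \<open>q^s * partial_mellin (p/q)\<close> with \<open>q = t(1-t)\<close>.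
\<close>

lemma truncated_mellin:
  assumes \<phi>: "C1_bounded \<phi> \<phi>' N" and \<delta>: "0 < \<delta>" "\<delta> \<le> 1/4" and a: "0 < a" "a \<le> b"
  shows "continuous_on {a..b} (\<lambda>p. of_real p powr (s - 1) * integral {\<delta>..1-\<delta>} (beta_kernel x y \<phi> p))"
    and "integral {a..b} (\<lambda>p. of_real p powr (s - 1) * integral {\<delta>..1-\<delta>} (beta_kernel x y \<phi> p)) =
      integral {\<delta>..1-\<delta>} (\<lambda>t. beta_weight (x + s) (y + s) t * \<phi> t * (partial_mellin (b / (t * (1 - t))) - partial_mellin (a / (t * (1 - t)))))"
proof -
  have cont: "continuous_on ({a..b} \<times> {\<delta>..1-\<delta>}) (\<lambda>(p,t). of_real p powr (s - 1) * beta_kernel x y \<phi> p t)"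
    unfolding beta_kernel_def[abs_def] split_beta
    by (intro continuous_intros continuous_on_compose2[OF continuous_on_beta_weight]
        continuous_on_compose2[OF C1_boundedD(3)[OF \<phi>, of UNIV]] continuous_on_compose2[OF continuous_on_W])
       (use a \<delta> in \<open>auto simp: complex_nonpos_Reals_iff\<close>)
  have eq: "of_real p powr (s - 1) * integral {\<delta>..1-\<delta>} (beta_kernel x y \<phi> p) =
     integral (cbox \<delta> (1-\<delta>)) (\<lambda>t. of_real p powr (s - 1) * beta_kernel x y \<phi> p t)" for p
    by simp
  show "continuous_on {a..b} (\<lambda>p. of_real p powr (s - 1) * integral {\<delta>..1-\<delta>} (beta_kernel x y \<phi> p))"
    unfolding eq by (rule integral_continuous_on_param) (use cont in simp)
  have "integral {a..b} (\<lambda>p. of_real p powr (s - 1) * integral {\<delta>..1-\<delta>} (beta_kernel x y \<phi> p)) =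
    integral (cbox \<delta> (1-\<delta>)) (\<lambda>t. integral (cbox a b) (\<lambda>p. of_real p powr (s - 1) * beta_kernel x y \<phi> p t))"
    unfolding eq cbox_interval[symmetric, of a b]
    by (rule integral_swap_continuous) (use cont in \<open>simp add: cbox_Pair_eq\<close>)
  also have "\<dots> = integral {\<delta>..1-\<delta>} (\<lambda>t. beta_weight (x + s) (y + s) t * \<phi> t * (partial_mellin (b / (t * (1 - t))) - partial_mellin (a / (t * (1 - t)))))"
    unfolding cbox_interval
  proof (rule integral_cong)
    fix t assume "t \<in> {\<delta>..1-\<delta>}"
    then have t: "0 < t" "0 < 1 - t" "0 < t * (1 - t)" using \<delta> by auto
    have "((\<lambda>p. of_real p powr (s - 1) * W (p / (t * (1 - t)))) has_integral
      of_real (t * (1 - t)) powr s * partial_mellin (b / (t * (1 - t))) - of_real (t * (1 - t)) powr s * partial_mellin (a / (t * (1 - t)))) {a..b}"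
    proof (rule fundamental_theorem_of_calculus)
      fix p assume "p \<in> {a..b}"
      then have p: "p > 0" "p / (t * (1 - t)) > 0" using a t by auto
      have "((\<lambda>p. p / (t * (1 - t))) has_vector_derivative 1 / (t * (1 - t))) (at p)"
        using t by (auto intro!: derivative_eq_intros simp: has_real_derivative_iff_has_vector_derivative[symmetric])
      from vector_diff_chain_at[OF this partial_mellin_has_vector_derivative[OF p(2)]]
      have "((\<lambda>p. of_real (t * (1 - t)) powr s * partial_mellin (p / (t * (1 - t)))) has_vector_derivative
         of_real (t * (1 - t)) powr s * ((1 / (t * (1 - t))) *\<^sub>R (of_real (p / (t * (1 - t))) powr (s - 1) * W (p / (t * (1 - t)))))) (at p)"
        by (intro has_vector_derivative_mult_right) (simp add: o_def)
      moreover have "of_real (t * (1 - t)) powr s * ((1 / (t * (1 - t))) *\<^sub>R (of_real (p / (t * (1 - t))) powr (s - 1) * W (p / (t * (1 - t)))))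
        = of_real p powr (s - 1) * W (p / (t * (1 - t)))"
        unfolding of_real_powr_divide[OF p(1) t(3)] using of_real_powr_Suc[OF t(3), of "s - 1"] t
        by (simp add: scaleR_conv_of_real divide_simps)
      ultimately show "((\<lambda>p. of_real (t * (1 - t)) powr s * partial_mellin (p / (t * (1 - t)))) has_vector_derivative
         of_real p powr (s - 1) * W (p / (t * (1 - t)))) (at p within {a..b})"
        by (simp add: has_vector_derivative_at_within)
    qed (use a in auto)
    from has_integral_mult_right[OF this, of "beta_weight x y t * \<phi> t"]
    have "integral {a..b} (\<lambda>p. of_real p powr (s - 1) * beta_kernel x y \<phi> p t) =
      beta_weight x y t * \<phi> t * (of_real (t * (1 - t)) powr s * partial_mellin (b / (t * (1 - t))) - of_real (t * (1 - t)) powr s * partial_mellin (a / (t * (1 - t))))"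
      by (intro integral_unique) (simp add: beta_kernel_def mult_ac)
    moreover have "beta_weight (x + s) (y + s) t = beta_weight x y t * of_real (t * (1 - t)) powr s"
    proof -
      have 1: "complex_of_real t powr (x + s - 1) = of_real t powr (x - 1) * of_real t powr s"
        by (simp flip: powr_add add: algebra_simps)
      have 2: "complex_of_real (1-t) powr (y + s - 1) = of_real (1-t) powr (y - 1) * of_real (1-t) powr s"
        by (simp flip: powr_add add: algebra_simps del: of_real_diff)
      show ?thesis unfolding beta_weight_def 1 2 of_real_powr_mult[OF t(1,2)] by (simp add: mult_ac)
    qed
    ultimately show "integral {a..b} (\<lambda>p. of_real p powr (s - 1) * beta_kernel x y \<phi> p t) =
      beta_weight (x + s) (y + s) t * \<phi> t * (partial_mellin (b / (t * (1 - t))) - partial_mellin (a / (t * (1 - t))))"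
      by (simp add: algebra_simps)
  qed
  finally show "integral {a..b} (\<lambda>p. of_real p powr (s - 1) * integral {\<delta>..1-\<delta>} (beta_kernel x y \<phi> p)) =
      integral {\<delta>..1-\<delta>} (\<lambda>t. beta_weight (x + s) (y + s) t * \<phi> t * (partial_mellin (b / (t * (1 - t))) - partial_mellin (a / (t * (1 - t)))))" .
qed

text \<open>
  The integral converges only conditionally, so dominated convergence is not available; instead the
  remainders of the exponential series tend to \<open>0\<close> in \<open>C^1\<close>, and \<open>beta_kernel_integral_bound\<close>
  applies.
\<close>

lemma beta_kernel_exp_sums:
  assumes x: "Re (x + s) > 0" and y: "Re (y + s) > 0" and p: "p > 0"
  shows "(\<lambda>n. integral {0..1} (beta_kernel x y (\<lambda>t. of_real t ^ n) p) * z ^ n / fact n) sums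
    integral {0..1} (beta_kernel x y (\<lambda>t. exp (z * of_real t)) p)"
proof -
  define J where "J = (\<lambda>\<phi>. integral {0..1} (beta_kernel x y \<phi> p))"
  obtain C where C: "\<And>\<phi> \<phi>' N. C1_bounded \<phi> \<phi>' N \<Longrightarrow> norm (J \<phi>) \<le> C * N"
    using beta_kernel_integral_bound[OF assms] unfolding J_def by blast
  have int_pow: "beta_kernel x y (\<lambda>t. of_real t ^ n) p integrable_on {0..1}" for n
    by (rule beta_kernel_integrable[OF x y C1_bounded_power p])
  have int_exp: "beta_kernel x y (\<lambda>t. exp (z * of_real t)) p integrable_on {0..1}"
  proof -
    have "beta_kernel x y (\<lambda>t. exp (z * of_real t)) p = (\<lambda>t. beta_kernel x y (\<lambda>t. exp (z * of_real t) - (\<Sum>n<Suc 0. (z * of_real t) ^ n / fact n)) p t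
       + beta_kernel x y (\<lambda>t. of_real t ^ 0) p t)"
      by (auto simp: beta_kernel_def algebra_simps)
    moreover have "\<dots> integrable_on {0..1}"
      by (intro integrable_add int_pow beta_kernel_integrable[OF x y C1_bounded_exp_minus_partial_sum p])
    ultimately show ?thesis by simp
  qed
  have part: "(\<Sum>n<k. J (\<lambda>t. of_real t ^ n) * z ^ n / fact n) = J (\<lambda>t. exp (z * of_real t)) -
      J (\<lambda>t. exp (z * of_real t) - (\<Sum>n<k. (z * of_real t) ^ n / fact n))" for k
  proof -
    have hi: "((\<lambda>t. beta_kernel x y (\<lambda>t. exp (z * of_real t)) p t - (\<Sum>n<k. beta_kernel x y (\<lambda>t. of_real t ^ n) p t * (z ^ n / fact n))) has_integral
       J (\<lambda>t. exp (z * of_real t)) - (\<Sum>n<k. J (\<lambda>t. of_real t ^ n) * (z ^ n / fact n))) {0..1}"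
      unfolding J_def
      by (intro has_integral_diff has_integral_sum has_integral_mult_left integrable_integral int_exp int_pow) auto
    have eq: "beta_kernel x y (\<lambda>t. exp (z * of_real t)) p t - (\<Sum>n<k. beta_kernel x y (\<lambda>t. of_real t ^ n) p t * (z ^ n / fact n)) =
        beta_kernel x y (\<lambda>t. exp (z * of_real t) - (\<Sum>n<k. (z * of_real t) ^ n / fact n)) p t" for t
      by (simp add: beta_kernel_def right_diff_distrib left_diff_distrib sum_distrib_left sum_distrib_right power_mult_distrib mult_ac)
    from integral_unique[OF hi[unfolded eq]] show ?thesis
      by (simp add: J_def)
  qed
  have bound: "norm (J (\<lambda>t. exp (z * of_real t) - (\<Sum>n<Suc k. (z * of_real t) ^ n / fact n)))
      \<le> C * ((norm z + 1) * exp_tail (norm z) k)" for k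
    by (rule C[OF C1_bounded_exp_minus_partial_sum])
  have "(\<lambda>k. C * ((norm z + 1) * exp_tail (norm z) k)) \<longlonglongrightarrow> C * ((norm z + 1) * 0)"
    by (intro tendsto_intros exp_tail_tendsto)
  then have lim: "(\<lambda>k. C * ((norm z + 1) * exp_tail (norm z) k)) \<longlonglongrightarrow> 0" by simp
  have "(\<lambda>k. J (\<lambda>t. exp (z * of_real t) - (\<Sum>n<Suc k. (z * of_real t) ^ n / fact n))) \<longlonglongrightarrow> 0"
    by (rule Lim_null_comparison[OF always_eventually[OF allI[OF bound]] lim])
  then have "(\<lambda>k. J (\<lambda>t. exp (z * of_real t) - (\<Sum>n<k. (z * of_real t) ^ n / fact n))) \<longlonglongrightarrow> 0"
    by (rule LIMSEQ_imp_Suc)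
  then have "(\<lambda>k. J (\<lambda>t. exp (z * of_real t)) - J (\<lambda>t. exp (z * of_real t) - (\<Sum>n<k. (z * of_real t) ^ n / fact n)))
      \<longlonglongrightarrow> J (\<lambda>t. exp (z * of_real t)) - 0"
    by (intro tendsto_intros)
  then have "(\<lambda>k. \<Sum>n<k. J (\<lambda>t. of_real t ^ n) * z ^ n / fact n) \<longlonglongrightarrow> J (\<lambda>t. exp (z * of_real t)) - 0"
    unfolding part .
  then show ?thesis unfolding sums_def by (simp add: J_def)
qed

text \<open>
  The function \<open>H\<close> is shown to be a primitive of the Mellin integrand \<open>h\<close> that is continuous at
  \<open>0\<close>: the truncated integrands converge to \<open>h\<close> uniformly on compact subsets of the positive
  axis, and their integrals converge to increments of \<open>H\<close>. The value of the Mellin integral is then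
  the limit of \<open>H\<close> at infinity.
\<close>

theorem has_integral_mellin_beta_kernel:
  assumes x: "Re (x + s) > 0" and y: "Re (y + s) > 0" and \<phi>: "C1_bounded \<phi> \<phi>' N"
  shows "((\<lambda>p. of_real p powr (s - 1) * integral {0..1} (beta_kernel x y \<phi> p)) has_integral
    (integral {0..} (\<lambda>v. of_real v powr (s - 1) * W v) *
     integral {0<..<1} (\<lambda>t. beta_weight (x + s) (y + s) t * \<phi> t))) {0..}"
proof -
  define v where "v = (\<lambda>t. beta_weight (x + s) (y + s) t * \<phi> t)"
  define h where "h = (\<lambda>p. of_real p powr (s - 1) * integral {0..1} (beta_kernel x y \<phi> p))"
  define H where "H = (\<lambda>p. integral {0<..<1} (\<lambda>t. v t * partial_mellin (p / (t * (1 - t)))))"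
  define M where "M = integral {0..} (\<lambda>v. of_real v powr (s - 1) * W v)"
  obtain K where K: "K \<ge> 0" "\<And>v. v \<ge> 0 \<Longrightarrow> norm (partial_mellin v) \<le> K" using partial_mellin_bounded by blast
  define g where "g = (\<lambda>t::real. N * K * (t powr (Re (x + s) - 1) * (1 - t) powr (Re (y + s) - 1)))"
  have g: "g integrable_on {0<..<1}"
    unfolding g_def using has_integral_Beta_real[OF x y]
    by (intro integrable_on_mult_right) (auto simp: has_integral_Icc_iff_Ioo)
  have contv: "continuous_on {0<..<1} v"
    unfolding v_def by (intro continuous_intros continuous_on_beta_weight C1_boundedD(3)[OF \<phi>])
  have bnd: "norm (v t * partial_mellin (p / (t * (1 - t)))) \<le> g t" if "t \<in> {0<..<1}" "p \<ge> 0" for t p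
  proof -
    have "norm (v t) \<le> t powr (Re (x + s) - 1) * (1 - t) powr (Re (y + s) - 1) * N"
      using that C1_boundedD(4)[OF \<phi>, of t]
      by (auto simp: v_def beta_weight_def norm_mult norm_powr_real_powr simp del: of_real_diff intro!: mult_left_mono)
    moreover have "norm (partial_mellin (p / (t * (1 - t)))) \<le> K" using that by (intro K) auto
    ultimately have "norm (v t) * norm (partial_mellin (p / (t * (1 - t)))) \<le> t powr (Re (x + s) - 1) * (1 - t) powr (Re (y + s) - 1) * N * K"
      using C1_boundedD(6)[OF \<phi>] by (intro mult_mono) auto
    then show ?thesis by (simp add: norm_mult g_def mult_ac)
  qed
  have int: "(\<lambda>t. v t * partial_mellin (p / (t * (1 - t)))) integrable_on {0<..<1}" if "p \<ge> 0" for p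
  proof (rule measurable_bounded_by_integrable_imp_integrable[OF _ g])
    have "continuous_on {0<..<1} (\<lambda>t. v t * partial_mellin (p / (t * (1 - t))))"
      using that by (intro continuous_intros contv continuous_on_compose2[OF continuous_on_partial_mellin]) auto
    then show "(\<lambda>t. v t * partial_mellin (p / (t * (1 - t)))) \<in> borel_measurable (lebesgue_on {0<..<1})"
      by (rule continuous_imp_measurable_on_sets_lebesgue) auto
  qed (use bnd that in auto)
  have H_seq: "(\<lambda>n. H (u n)) \<longlonglongrightarrow> integral {0<..<1} (\<lambda>t. v t * L t)"
    if "\<And>n. u n \<ge> 0" "\<And>t. t \<in> {0<..<1} \<Longrightarrow> (\<lambda>n. partial_mellin (u n / (t * (1 - t)))) \<longlonglongrightarrow> L t" for u L
    unfolding H_def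
    by (rule dominated_convergence(2)[OF _ g]) (use that int bnd in \<open>auto intro!: tendsto_mult_left\<close>)
  have H_cont: "continuous_on {0..} H"
  proof (rule continuous_on_sequentiallyI)
    fix u a assume u: "\<forall>n. u n \<in> {0::real..}" and a: "a \<in> {0..}" and ua: "u \<longlonglongrightarrow> a"
    have "(\<lambda>n. partial_mellin (u n / (t * (1 - t)))) \<longlonglongrightarrow> partial_mellin (a / (t * (1 - t)))" if "t \<in> {0<..<1}" for t
    proof (rule continuous_on_tendsto_compose[OF continuous_on_partial_mellin])
      show "(\<lambda>n. u n / (t * (1 - t))) \<longlonglongrightarrow> a / (t * (1 - t))"
        using that by (intro tendsto_intros ua) auto
    qed (use u a that in auto)
    from H_seq[OF _ this] u show "(\<lambda>n. H (u n)) \<longlonglongrightarrow> H a" by (auto simp: H_def)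
  qed
  have H_top: "(H \<longlongrightarrow> M * integral {0<..<1} v) at_top"
  proof (rule tendsto_at_topI_sequentially)
    fix u :: "nat \<Rightarrow> real" assume u: "filterlim u at_top sequentially"
    \<comment> \<open>\<open>H\<close> is controlled on the nonnegative axis only, where the sequence lies eventually.\<close>
    define u' where "u' = (\<lambda>n. max 0 (u n))"
    have u': "filterlim u' at_top sequentially"
      unfolding u'_def by (rule filterlim_at_top_mono[OF u]) auto
    have "(\<lambda>n. partial_mellin (u' n / (t * (1 - t)))) \<longlonglongrightarrow> M" if "t \<in> {0<..<1}" for t
    proof -
      have "filterlim (\<lambda>n. u' n / (t * (1 - t))) at_top sequentially"
        using filterlim_at_top_mult_tendsto_pos[OF tendsto_const _ u', of "1 / (t * (1 - t))"] that by simp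
      from filterlim_compose[OF partial_mellin_tendsto this] show ?thesis by (simp add: M_def)
    qed
    from H_seq[OF _ this] have "(\<lambda>n. H (u' n)) \<longlonglongrightarrow> integral {0<..<1} (\<lambda>t. v t * M)"
      by (auto simp: u'_def)
    moreover have "\<forall>\<^sub>F n in sequentially. H (u' n) = H (u n)"
      using u unfolding filterlim_at_top
      by (auto elim!: eventually_mono allE[of _ 0] simp: u'_def)
    ultimately have "(\<lambda>n. H (u n)) \<longlonglongrightarrow> integral {0<..<1} (\<lambda>t. v t * M)"
      by (rule Lim_transform_eventually)
    then show "(\<lambda>n. H (u n)) \<longlonglongrightarrow> M * integral {0<..<1} v"
      by (simp add: mult.commute)
  qed
  \<comment> \<open>Any null sequence in \<open>(0, 1/4]\<close> would do.\<close>
  define \<delta> where "\<delta> = (\<lambda>n. 1 / (real n + 4))"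
  have \<delta>: "0 < \<delta> n" "\<delta> n \<le> 1/4" for n by (auto simp: \<delta>_def field_simps)
  have \<delta>0: "\<delta> \<longlonglongrightarrow> 0" unfolding \<delta>_def by real_asymp
  have trunc: "(\<lambda>n. integral {\<delta> n..1 - \<delta> n} (\<lambda>t. v t * partial_mellin (p / (t * (1 - t))))) \<longlonglongrightarrow> H p" if p: "p \<ge> 0" for p
  proof -
    have inter: "{\<delta> n..1 - \<delta> n} \<inter> {0<..<1} = {\<delta> n..1 - \<delta> n}" for n using \<delta>[of n] by auto
    have "(\<lambda>n. integral {0<..<1} (\<lambda>t. if t \<in> {\<delta> n..1 - \<delta> n} then v t * partial_mellin (p / (t * (1 - t))) else 0)) \<longlonglongrightarrow> H p"
      unfolding H_def
    proof (rule dominated_convergence(2)[OF _ g])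
      fix n
      show "(\<lambda>t. if t \<in> {\<delta> n..1 - \<delta> n} then v t * partial_mellin (p / (t * (1 - t))) else 0) integrable_on {0<..<1}"
        unfolding integrable_restrict_Int inter
        by (rule integrable_on_subinterval[OF int[OF p]]) (use \<delta>[of n] in auto)
      fix t :: real assume t: "t \<in> {0<..<1}"
      show "norm (if t \<in> {\<delta> n..1 - \<delta> n} then v t * partial_mellin (p / (t * (1 - t))) else 0) \<le> g t"
        using bnd[OF t p] order_trans[OF norm_ge_zero bnd[OF t p]] by auto
    next
      fix t :: real assume t: "t \<in> {0<..<1}"
      have "\<forall>\<^sub>F n in sequentially. \<delta> n < min t (1 - t)"
        using \<delta>0 t by (intro order_tendstoD) auto
      then show "(\<lambda>n. if t \<in> {\<delta> n..1 - \<delta> n} then v t * partial_mellin (p / (t * (1 - t))) else 0) \<longlonglongrightarrow> v t * partial_mellin (p / (t * (1 - t)))"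
        by (intro tendsto_eventually) (erule eventually_mono, auto)
    qed
    then show ?thesis unfolding integral_restrict_Int inter .
  qed
  obtain C where C: "C \<ge> 0" "\<And>\<phi> \<phi>' N \<delta> p. C1_bounded \<phi> \<phi>' N \<Longrightarrow> 0 < \<delta> \<Longrightarrow> \<delta> \<le> 1/4 \<Longrightarrow> p > 0 \<Longrightarrow>
     norm (of_real p powr s * (integral {0..1} (beta_kernel x y \<phi> p) - integral {\<delta>..1-\<delta>} (beta_kernel x y \<phi> p)))
       \<le> C * N * (\<delta> powr Re (x + s) + \<delta> powr Re (y + s))"
    using tail_bound[OF x y] by blast
  define h\<delta> where "h\<delta> = (\<lambda>n p. of_real p powr (s - 1) * integral {\<delta> n..1 - \<delta> n} (beta_kernel x y \<phi> p))"
  have unif: "uniform_limit {a..b} h\<delta> h sequentially" if "a > 0" for a b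
  proof (rule uniform_limitI)
    fix e :: real assume e: "e > 0"
    have "(\<lambda>n. C * N * (\<delta> n powr Re (x + s) + \<delta> n powr Re (y + s)) / a) \<longlonglongrightarrow> 0"
      using x y \<delta>0 \<delta>(1) that
      by (auto intro!: tendsto_eq_intros simp: less_imp_le)
    then have "\<forall>\<^sub>F n in sequentially. C * N * (\<delta> n powr Re (x + s) + \<delta> n powr Re (y + s)) / a < e"
      using e by (rule order_tendstoD)
    then show "\<forall>\<^sub>F n in sequentially. \<forall>p\<in>{a..b}. dist (h\<delta> n p) (h p) < e"
    proof (rule eventually_mono, safe)
      fix n p assume *: "C * N * (\<delta> n powr Re (x + s) + \<delta> n powr Re (y + s)) / a < e" and p: "p \<in> {a..b}"
      define D where "D = integral {0..1} (beta_kernel x y \<phi> p) - integral {\<delta> n..1 - \<delta> n} (beta_kernel x y \<phi> p)"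
      have p0: "p > 0" using p that by auto
      have "p * norm (of_real p powr (s - 1) * D) = norm (of_real p powr s * D)"
        using of_real_powr_Suc[OF p0, of "s - 1"] p0 by (simp add: norm_mult)
      also have "\<dots> \<le> C * N * (\<delta> n powr Re (x + s) + \<delta> n powr Re (y + s))"
        unfolding D_def by (rule C(2)[OF \<phi> \<delta> p0])
      finally have "p * norm (of_real p powr (s - 1) * D) \<le> C * N * (\<delta> n powr Re (x + s) + \<delta> n powr Re (y + s))" .
      moreover have "a * norm (of_real p powr (s - 1) * D) \<le> p * norm (of_real p powr (s - 1) * D)"
        using p by (intro mult_right_mono) auto
      ultimately have "norm (of_real p powr (s - 1) * D) \<le> C * N * (\<delta> n powr Re (x + s) + \<delta> n powr Re (y + s)) / a"
        using that by (simp add: field_simps)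
      also note *
      finally show "dist (h\<delta> n p) (h p) < e"
        by (simp add: h\<delta>_def h_def D_def dist_norm norm_minus_commute right_diff_distrib)
    qed
  qed
  have h_cont: "continuous_on {a..b} h" if "a > 0" "a \<le> b" for a b
    by (rule uniform_limit_theorem[OF _ unif[OF that(1)]])
       (use truncated_mellin(1)[OF \<phi> \<delta> that] in \<open>auto simp: h\<delta>_def\<close>)
  have h_int: "(h has_integral (H b - H a)) {a..b}" if ab: "a > 0" "a \<le> b" for a b
  proof -
    obtain I J where IJ: "\<And>n. (h\<delta> n has_integral I n) {a..b}" "(h has_integral J) {a..b}" "I \<longlonglongrightarrow> J"
      using uniform_limit_integral[OF unif[OF ab(1), of b]] truncated_mellin(1)[OF \<phi> \<delta> ab] 
      by (auto simp: h\<delta>_def)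
    have I_eq: "I n = integral {\<delta> n..1 - \<delta> n} (\<lambda>t. v t * partial_mellin (b / (t * (1 - t)))) -
       integral {\<delta> n..1 - \<delta> n} (\<lambda>t. v t * partial_mellin (a / (t * (1 - t))))" for n
    proof -
      have "I n = integral {\<delta> n..1 - \<delta> n} (\<lambda>t. v t * partial_mellin (b / (t * (1 - t))) - v t * partial_mellin (a / (t * (1 - t))))"
        using integral_unique[OF IJ(1)[of n]] truncated_mellin(2)[OF \<phi> \<delta> ab, where n1 = n]
        by (simp add: h\<delta>_def v_def right_diff_distrib)
      also have "\<dots> = integral {\<delta> n..1 - \<delta> n} (\<lambda>t. v t * partial_mellin (b / (t * (1 - t)))) -
         integral {\<delta> n..1 - \<delta> n} (\<lambda>t. v t * partial_mellin (a / (t * (1 - t))))"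
        by (rule integral_diff; rule integrable_on_subinterval[OF int]) (use ab \<delta>[of n] in auto)
      finally show ?thesis .
    qed
    have "(\<lambda>n. integral {\<delta> n..1 - \<delta> n} (\<lambda>t. v t * partial_mellin (b / (t * (1 - t)))) -
       integral {\<delta> n..1 - \<delta> n} (\<lambda>t. v t * partial_mellin (a / (t * (1 - t))))) \<longlonglongrightarrow> H b - H a"
      using ab by (intro tendsto_diff trunc) auto
    then have "I \<longlonglongrightarrow> H b - H a"
      by (rule Lim_transform_eventually) (simp add: I_eq)
    with IJ(3) have "J = H b - H a" by (rule LIMSEQ_unique)
    with IJ(2) show ?thesis by simp
  qed
  have H_deriv: "(H has_vector_derivative h p) (at p)" if "p > 0" for p
  proof -
    have "((\<lambda>u. integral {p/2..u} h) has_vector_derivative h p) (at p within {p/2..p+1})"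
      by (rule integral_has_vector_derivative[OF h_cont]) (use that in auto)
    moreover have "at p within {p/2..p+1} = at p"
      using that by (intro at_within_interior) auto
    ultimately have "((\<lambda>u. integral {p/2..u} h + H (p/2)) has_vector_derivative h p + 0) (at p)"
      by (intro has_vector_derivative_add) auto
    then have "((\<lambda>u. integral {p/2..u} h + H (p/2)) has_vector_derivative h p) (at p)" by simp
    then show ?thesis
    proof (rule has_vector_derivative_transform_within_open)
      show "open {p/2<..}" "p \<in> {p/2<..}" using that by auto
      fix u assume "u \<in> {p/2<..}"
      then show "integral {p/2..u} h + H (p/2) = H u"
        using integral_unique[OF h_int[of "p/2" u]] that by simp
    qed
  qed
  have "(h has_integral (H b - H 0)) {0..b}" if "b \<ge> 0" for b
    using that by (intro fundamental_theorem_of_calculus_interior continuous_on_subset[OF H_cont] H_deriv) auto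
  moreover have "H 0 = 0" by (simp add: H_def partial_mellin_0)
  ultimately have "(h has_integral H b) {0..b}" if "b \<ge> 0" for b using that by simp
  from has_integral_improper[OF this H_top] show ?thesis
    by (simp add: h_def M_def v_def)
qed

end

section \<open>The Mellin transform of the confluent function\<close>

theorem theorem3p7:
  fixes \<alpha> \<beta> b c z s :: complex
  assumes "Re \<alpha> > -1"
    and "Re c > Re b" and "Re b > 0"
    and "Re s > 0"
    and psi_gamma_converges:
      "(\<lambda>v::real. of_real v powr (s - 1) * wright \<alpha> \<beta> (- of_real v)) integrable_on {0..}"
  shows "mellin_converges (\<lambda>p. psi_confluent \<alpha> \<beta> (of_real p) b c z) s \<and>
    mellin (\<lambda>p. psi_confluent \<alpha> \<beta> (of_real p) b c z) s =
      psi_gamma \<alpha> \<beta> 0 s * Beta (b + s) (c + s - b) / Beta b (c - b) *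
        confluent (b + s) (c + 2 * s) z"
proof -
  define W where "W = (\<lambda>v::real. wright \<alpha> \<beta> (- of_real v))"
  interpret mellin_kernel W s
  proof
    have "continuous_on UNIV (wright \<alpha> \<beta>)"
      by (intro continuous_at_imp_continuous_on ballI isCont_wright assms(1))
    then show "continuous_on {0<..} W"
      unfolding W_def by (rule continuous_on_compose2) (auto intro!: continuous_intros)
    show "(\<lambda>v. of_real v powr (s - 1) * W v) integrable_on {0..}"
      using psi_gamma_converges by (simp add: W_def)
  qed
  have x: "Re (b + s) > 0" and y: "Re (c - b + s) > 0" using assms by auto
  define J where "J = (\<lambda>p. integral {0..1} (beta_kernel b (c - b) (\<lambda>t. exp (z * of_real t)) p))"
  have psi_beta: "psi_beta \<alpha> \<beta> (of_real p) (b + of_nat n) (c - b) = integral {0..1} (beta_kernel b (c - b) (\<lambda>t. of_real t ^ n) p)" for n p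
    unfolding psi_beta_def
  proof (rule integral_cong)
    fix t :: real assume "t \<in> {0..1}"
    then have "beta_weight (b + of_nat n) (c - b) t * W (p / (t * (1 - t))) = beta_kernel b (c - b) (\<lambda>t. of_real t ^ n) p t"
      by (simp add: beta_kernel_def beta_weight_power)
    then show "of_real t powr (b + of_nat n - 1) * of_real (1 - t) powr (c - b - 1) * wright \<alpha> \<beta> (- (of_real p / of_real (t * (1 - t)))) =
      beta_kernel b (c - b) (\<lambda>t. of_real t ^ n) p t"
      by (simp add: W_def beta_weight_def)
  qed
  have confl: "psi_confluent \<alpha> \<beta> (of_real p) b c z = J p / Beta b (c - b)" if "p > 0" for p
  proof -
    from sums_divide[OF beta_kernel_exp_sums[OF x y that, of z], of "Beta b (c - b)"]
    show ?thesis
      unfolding psi_confluent_def psi_beta J_def by (simp add: sums_iff field_simps)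
  qed
  obtain N where N: "C1_bounded (\<lambda>t. exp (z * of_real t)) (\<lambda>t. z * exp (z * of_real t)) N"
    using C1_bounded_exp by blast
  have M: "psi_gamma \<alpha> \<beta> 0 s = integral {0..} (\<lambda>v. of_real v powr (s - 1) * W v)"
    by (simp add: psi_gamma_def W_def)
  have "b + s + (c - b + s) = c + 2 * s" by simp
  with has_integral_mellin_beta_kernel[OF x y N] beta_weight_exp_integral[OF x y, of z]
  have "((\<lambda>p. of_real p powr (s - 1) * J p) has_integral psi_gamma \<alpha> \<beta> 0 s * (Beta (b + s) (c - b + s) * confluent (b + s) (c + 2 * s) z)) {0..}"
    by (simp add: J_def M)
  from has_integral_divide[OF this, of "Beta b (c - b)"]
  have "((\<lambda>p. of_real p powr (s - 1) * psi_confluent \<alpha> \<beta> (of_real p) b c z) has_integral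
     psi_gamma \<alpha> \<beta> 0 s * (Beta (b + s) (c - b + s) * confluent (b + s) (c + 2 * s) z) / Beta b (c - b)) {0..}"
  proof (rule has_integral_eq[rotated])
    fix p :: real assume "p \<in> {0..}"
    then show "of_real p powr (s - 1) * J p / Beta b (c - b) = of_real p powr (s - 1) * psi_confluent \<alpha> \<beta> (of_real p) b c z"
      using confl[of p] by (cases "p = 0") auto
  qed
  moreover have "c - b + s = c + s - b" by simp
  ultimately show ?thesis
    unfolding mellin_converges_def mellin_def by (auto simp: has_integral_iff mult_ac)
qed

end
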